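(* Let $N\ge3$ and $\mu\ne0$. In the continuous-time Brownian sensor model described in the context, let $T_h$ be the second-alarm rule, i.e. the second smallest of the $N$ individual CUSUM alarm times $T^{(1)}_h,\dots,T^{(N)}_h$ with threshold $h>0$. Then the detection delay of $T_h$ scales with the average run length at most logarithmically: as $h\to\infty$, $$d(T_h)\le\frac{4}{\mu^2}\left(\log(\mathrm{ARL}(T_h))+\log\frac{(N-1)\mu^2}{2}-1+o(1)\right).$$
   Context: **Model.** There are $N\ge 3$ sensors. Sensor $n\in\{1,\dots,N\}$ observes $\xi^{(n)}_t=\mu(t-\tau)^++W^{(n)}_t$, $t\ge 0$, where $\mu\ne0$ is a known constant, $W^{(1)},\dots,W^{(N)}$ are independent standard Brownian motions, and $\tau\in[0,\infty]$ is an unknown deterministic change time ($\tau=\infty$ means no change). One unknown sensor $n^c\in\{1,\dots,N\}$ may be compromised. Sensor $n$ reports $\bar\xi^{(n)}_t$ to a fusion center. If $n$ is honest then $\bar\xi^{(n)}=\xi^{(n)}$; for the compromised sensor, $\bar\xi^{(n^c)}$ is determined by an attack strategy $\mathfrak{s}$, which can use the signal $\xi^{(n^c)}$ observed by the attacker, and on which no assumption is made. Let $\mathcal{F}_t=\sigma\{(\bar\xi^{(1)}_s,\dots,\bar\xi^{(N)}_s):s\le t\}$. $E_{\tau,n^c,\mathfrak{s}}$ denotes expectation when the change occurs at $\tau$, the compromised sensor is $n^c$ and it uses strategy $\mathfrak{s}$ ($\tau=\infty$: no change). **Performance measures.** For a stopping time $T$ of $(\mathcal{F}_t)$, $$d(T)=\sup_{\tau<\infty,\,n^c,\,\mathfrak{s}}\operatorname{ess\,sup}\,E_{\tau,n^c,\mathfrak{s}}[(T-\tau)^+\mid\mathcal{F}_\tau],\qquad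 \mathrm{ARL}(T)=\inf_{n^c,\mathfrak{s}}E_{\infty,n^c,\mathfrak{s}}[T].$$ **Second-alarm scheme.** For each $n$ let $$y^{(n)}_t=\mu\bar\xi^{(n)}_t-\tfrac12\mu^2t-\inf_{0\le s\le t}\left(\mu\bar\xi^{(n)}_s-\tfrac12\mu^2s\right),\qquad T^{(n)}_h=\inf\{t\ge0:y^{(n)}_t\ge h\}.$$ $T_h$ is the second order statistic (second smallest value) of $T^{(1)}_h,\dots,T^{(N)}_h$. *)

theory Defs
  imports "HOL-Probability.Probability"
begin

section \<open>Brownian motion and the honest signals\<close>

text \<open>The \<open>\<sigma>\<close>-algebra on \<open>space M\<close> generated by a family of real random variables; only the
  underlying space and sets of this measure are ever used.\<close>

definition generated_by :: "'a measure \<Rightarrow> 'i set \<Rightarrow> ('i \<Rightarrow> 'a \<Rightarrow> real) \<Rightarrow> 'a measure" where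
  "generated_by M I X =
     sigma (space M) (\<Union>i\<in>I. {X i -` A \<inter> space M | A. A \<in> sets borel})"

text \<open>Processes are indexed by \<open>real\<close> but only times \<open>t \<ge> 0\<close> are meaningful. All paths are
  continuous from 0, so that no completion of \<open>M\<close> is needed for hitting times to be measurable.\<close>

definition standard_brownian_motion :: "'a measure \<Rightarrow> (real \<Rightarrow> 'a \<Rightarrow> real) \<Rightarrow> bool" where
  "standard_brownian_motion M B \<longleftrightarrow>
     prob_space M \<and>
     (\<forall>t\<ge>0. B t \<in> borel_measurable M) \<and>
     (\<forall>\<omega>\<in>space M. B 0 \<omega> = 0 \<and> continuous_on {0..} (\<lambda>t. B t \<omega>)) \<and>
     (\<forall>s t. 0 \<le> s \<and> s < t \<longrightarrow>
        distributed M lborel (\<lambda>\<omega>. B t \<omega> - B s \<omega>) (\<lambda>x. ennreal (normal_density 0 (sqrt (t - s)) x)) \<and>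
        prob_space.indep_set M (sets (generated_by M {0..s} B))
          (sets (generated_by M {()} (\<lambda>_ \<omega>. B t \<omega> - B s \<omega>))))"

definition sensor_noise :: "'a measure \<Rightarrow> nat \<Rightarrow> (nat \<Rightarrow> real \<Rightarrow> 'a \<Rightarrow> real) \<Rightarrow> bool" where
  "sensor_noise M N W \<longleftrightarrow>
     prob_space M \<and>
     (\<forall>n\<in>{1..N}. standard_brownian_motion M (W n)) \<and>
     prob_space.indep_vars M (\<lambda>_. Pi\<^sub>M {0::real..} (\<lambda>_. borel))
       (\<lambda>n \<omega>. \<lambda>t\<in>{0..}. W n t \<omega>) {1..N}"

text \<open>The change time ranges over \<open>[0,\<infinity>]\<close>. The truncated subtraction of \<^typ>\<open>ennreal\<close> is
  \<open>(t - \<tau>)\<^sup>+\<close>, and it is 0 for \<open>\<tau> = \<infinity>\<close>, i.e. when there is no change.\<close>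

definition signal ::
  "(nat \<Rightarrow> real \<Rightarrow> 'a \<Rightarrow> real) \<Rightarrow> real \<Rightarrow> ennreal \<Rightarrow> nat \<Rightarrow> real \<Rightarrow> 'a \<Rightarrow> real" where
  "signal W \<mu> \<tau> n t \<omega> = \<mu> * enn2real (ennreal t - \<tau>) + W n t \<omega>"


section \<open>Attacks\<close>

text \<open>An attack is represented by the process \<open>Z\<close> that the compromised sensor \<open>c\<close> reports in place
  of its own signal.\<close>

definition reports ::
  "(nat \<Rightarrow> real \<Rightarrow> 'a \<Rightarrow> real) \<Rightarrow> real \<Rightarrow> ennreal \<Rightarrow> nat \<Rightarrow> (real \<Rightarrow> 'a \<Rightarrow> real)
     \<Rightarrow> nat \<Rightarrow> real \<Rightarrow> 'a \<Rightarrow> real" where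
  "reports W \<mu> \<tau> c Z n t \<omega> = (if n = c then Z t \<omega> else signal W \<mu> \<tau> n t \<omega>)"

definition report_filtration ::
  "'a measure \<Rightarrow> nat \<Rightarrow> (nat \<Rightarrow> real \<Rightarrow> 'a \<Rightarrow> real) \<Rightarrow> real \<Rightarrow> 'a measure" where
  "report_filtration M N X t = generated_by M ({1..N} \<times> {0..t}) (\<lambda>(n, s). X n s)"

text \<open>Increments after time \<open>t\<close> of the noise of the honest sensors.\<close>

definition honest_future ::
  "'a measure \<Rightarrow> nat \<Rightarrow> (nat \<Rightarrow> real \<Rightarrow> 'a \<Rightarrow> real) \<Rightarrow> nat \<Rightarrow> real \<Rightarrow> 'a measure" where
  "honest_future M N W c t =
     generated_by M (({1..N} - {c}) \<times> {t..}) (\<lambda>(n, u) \<omega>. W n u \<omega> - W n t \<omega>)"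

text \<open>The reported process \<open>Z\<close> is arbitrary: no path regularity, no prescribed law, arbitrary
  (even anticipating) use of the attacker's own signal, arbitrary randomisation, knowledge of the
  change time and even of the past of the other sensors. The only requirement besides measurability
  is that at no time do the reports disclose the future noise of the honest sensors, which the
  attacker does not observe.\<close>

definition attack ::
  "'a measure \<Rightarrow> nat \<Rightarrow> (nat \<Rightarrow> real \<Rightarrow> 'a \<Rightarrow> real) \<Rightarrow> real \<Rightarrow> ennreal \<Rightarrow> nat
     \<Rightarrow> (real \<Rightarrow> 'a \<Rightarrow> real) \<Rightarrow> bool" where
  "attack M N W \<mu> \<tau> c Z \<longleftrightarrow>
     (\<forall>t\<ge>0. Z t \<in> borel_measurable M) \<and>
     (\<forall>t\<ge>0. prob_space.indep_set M
        (sets (report_filtration M N (reports W \<mu> \<tau> c Z) t))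
        (sets (honest_future M N W c t)))"


section \<open>Performance measures\<close>

text \<open>A detection rule maps the \<open>N\<close> reported paths to a time in \<open>[0,\<infinity>]\<close>.\<close>

type_synonym rule = "(nat \<Rightarrow> real \<Rightarrow> real) \<Rightarrow> ennreal"

definition stop_at :: "rule \<Rightarrow> (nat \<Rightarrow> real \<Rightarrow> 'a \<Rightarrow> real) \<Rightarrow> 'a \<Rightarrow> ennreal" where
  "stop_at T X \<omega> = T (\<lambda>n t. X n t \<omega>)"

text \<open>The pairs \<open>(n\<^sup>c, \<s>)\<close>. As the reported paths may be completely irregular, we have to ask that
  the detection time be a random variable, for otherwise its expectation is not defined.\<close>

definition attacks ::
  "'a measure \<Rightarrow> nat \<Rightarrow> (nat \<Rightarrow> real \<Rightarrow> 'a \<Rightarrow> real) \<Rightarrow> real \<Rightarrow> ennreal \<Rightarrow> rule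
     \<Rightarrow> (nat \<times> (real \<Rightarrow> 'a \<Rightarrow> real)) set" where
  "attacks M N W \<mu> \<tau> T =
     {(c, Z). c \<in> {1..N} \<and> attack M N W \<mu> \<tau> c Z \<and>
              stop_at T (reports W \<mu> \<tau> c Z) \<in> borel_measurable M}"

definition delay ::
  "'a measure \<Rightarrow> nat \<Rightarrow> (nat \<Rightarrow> real \<Rightarrow> 'a \<Rightarrow> real) \<Rightarrow> real \<Rightarrow> rule \<Rightarrow> ennreal" where
  "delay M N W \<mu> T =
     (SUP \<tau>\<in>{0::real..}. SUP (c, Z)\<in>attacks M N W \<mu> (ennreal \<tau>) T.
        esssup M (nn_cond_exp M
          (report_filtration M N (reports W \<mu> (ennreal \<tau>) c Z) \<tau>)
          (\<lambda>\<omega>. stop_at T (reports W \<mu> (ennreal \<tau>) c Z) \<omega> - ennreal \<tau>)))"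

definition ARL ::
  "'a measure \<Rightarrow> nat \<Rightarrow> (nat \<Rightarrow> real \<Rightarrow> 'a \<Rightarrow> real) \<Rightarrow> real \<Rightarrow> rule \<Rightarrow> ennreal" where
  "ARL M N W \<mu> T =
     (INF (c, Z)\<in>attacks M N W \<mu> \<infinity> T. \<integral>\<^sup>+ \<omega>. stop_at T (reports W \<mu> \<infinity> c Z) \<omega> \<partial>M)"


section \<open>The second-alarm rule\<close>

text \<open>Computed in \<^typ>\<open>ereal\<close> because the running infimum of an attacker's path may be \<open>-\<infinity>\<close>.\<close>

definition cusum :: "real \<Rightarrow> (real \<Rightarrow> real) \<Rightarrow> real \<Rightarrow> ereal" where
  "cusum \<mu> x t =
     ereal (\<mu> * x t - \<mu>\<^sup>2 * t / 2) - (INF s\<in>{0..t}. ereal (\<mu> * x s - \<mu>\<^sup>2 * s / 2))"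

definition alarm :: "real \<Rightarrow> real \<Rightarrow> (real \<Rightarrow> real) \<Rightarrow> ennreal" where
  "alarm \<mu> h x = Inf {ennreal t | t. 0 \<le> t \<and> cusum \<mu> x t \<ge> ereal h}"

definition second_alarm :: "nat \<Rightarrow> real \<Rightarrow> real \<Rightarrow> rule" where
  "second_alarm N \<mu> h x = sort (map (\<lambda>n. alarm \<mu> h (x n)) [1..<N + 1]) ! 1"

definition ln_ext :: "ennreal \<Rightarrow> ereal" where
  "ln_ext a = (if a = 0 then -\<infinity> else if a = \<infinity> then \<infinity> else ereal (ln (enn2real a)))"

end

theory Submission
  imports Defs "HOL-Combinatorics.Permutations" "HOL-Real_Asymp.Real_Asymp"
begin

text \<open>
  Two bounds are proved for every \<open>h > 0\<close>: the delay is at most \<open>4 / \<mu>\<^sup>2 * (h - 1 + exp (- h))\<close>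
  (\<open>delay_second_alarm_le\<close>), and the average run length is at least
  \<open>2 / ((N - 1) * \<mu>\<^sup>2) * (exp h - h - 1)\<close> (\<open>ARL_second_alarm_ge\<close>). The logarithm of the second is
  \<open>h - ln ((N - 1) * \<mu>\<^sup>2 / 2)\<close> up to \<open>o(1)\<close>, and eliminating \<open>h\<close> gives the claim.

  Let \<open>y\<close> be the CUSUM statistic of an honest sensor. It is a Brownian motion with variance \<open>\<mu>\<^sup>2\<close> per
  unit of time and drift \<open>\<mu>\<^sup>2 / 2\<close> after, \<open>- \<mu>\<^sup>2 / 2\<close> before the change, reflected at 0. After the
  change \<open>y + exp (- y)\<close> grows at the mean rate \<open>\<mu>\<^sup>2 / 2\<close>, as its derivative at 0 vanishes and so
  reflection does not contribute. Hence \<open>y\<close> needs the mean time \<open>2 / \<mu>\<^sup>2 * (h + exp (- h) - 1)\<close> from 0 to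
  \<open>h\<close>, and no more from any other value that it may have at the change. Among the \<open>N - 1 \<ge> 2\<close> honest
  sensors there are two, and once both have alarmed so has the rule, whatever the compromised
  sensor reports. The later of the two alarms is delayed by at most the sum of both delays.

  Without change \<open>exp y - y\<close> grows at the mean rate \<open>\<mu>\<^sup>2 / 2\<close>. As only one of the two alarms required
  can come from the compromised sensor, the rule does not stop before the first alarm of an honest
  sensor. At that time the sum of \<open>exp y - y - 1\<close> over the honest sensors is at least
  \<open>exp h - h - 1\<close>, while its mean is \<open>(N - 1) * \<mu>\<^sup>2 / 2\<close> times the mean of that time.

  Instead of stochastic calculus the proof uses the CUSUM statistic on a time grid,
  \<open>max 0 (y + x)\<close> being its value one step after \<open>y\<close>, with Gaussian increments \<open>x\<close> that are independent
  of everything reported so far. Both potential functions are smallest at 0, so reflection can only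
  lower them. This is the right direction for the run length, where the one-step estimate
  (\<open>step_below_drift\<close>) has no error at all; the passage to continuous time then lowers the threshold
  slightly and uses continuity of the honest paths and Fatou's lemma (\<open>run_length_on_event\<close>). For
  the delay it is the wrong direction. There the potential is shifted by a small \<open>b > 0\<close>, so that
  it is increasing down to \<open>- b\<close> and reflection raises it, except for steps larger than \<open>b\<close>, whose
  contribution vanishes as the grid is refined (\<open>exp_minus_clamp_ge\<close>, \<open>step_above_drift\<close>). No
  discretisation error arises on this side, because the grid statistic alarms no earlier than the
  true one. All estimates hold on each event of the reports up to the change, and so they bound
  the conditional expectation.
\<close>

section \<open>The second smallest entry of a list\<close>

lemma sort_nth_permutes:
  fixes xs :: "'b::linorder list"
  obtains p where "p permutes {..<length xs}" "\<And>i. i < length xs \<Longrightarrow> sort xs ! i = xs ! p i"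
proof -
  have "mset (sort xs) = mset xs" by simp
  then obtain p where p: "p permutes {..<length xs}" "permute_list p xs = sort xs"
    by (metis mset_eq_permutation)
  have "sort xs ! i = xs ! p i" if "i < length xs" for i
    using p that by (metis permute_list_nth)
  with p(1) show thesis by (rule that)
qed

text \<open>Of two different positions of the list, sorting moves at least one to an index \<ge> 1.\<close>
lemma sort_nth_1_le_max:
  fixes xs :: "'b::linorder list"
  assumes "i < length xs" "j < length xs" "i \<noteq> j"
  shows "sort xs ! 1 \<le> max (xs ! i) (xs ! j)"
proof -
  obtain p where p: "p permutes {..<length xs}" "\<And>i. i < length xs \<Longrightarrow> sort xs ! i = xs ! p i"
    using sort_nth_permutes by blast
  obtain i' j' where ij: "p i' = i" "p j' = j" using p(1) by (metis permutes_surj surj_def)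
  have lt: "i' < length xs" "j' < length xs"
    using assms(1,2) ij permutes_in_image[OF p(1)] by fastforce+
  have "max i' j' \<ge> 1" using assms(3) ij by (cases "i' = 0"; cases "j' = 0") auto
  then have "sort xs ! 1 \<le> sort xs ! (max i' j')"
    using lt by (intro sorted_nth_mono) auto
  also have "\<dots> \<le> max (xs ! i) (xs ! j)"
    using p(2)[OF lt(1)] p(2)[OF lt(2)] ij by (auto simp: max_def)
  finally show ?thesis .
qed

text \<open>The two smallest entries come from different positions, and only one of these can be \<open>c\<close>.\<close>
lemma nth_le_sort_nth_1:
  fixes xs :: "'b::linorder list"
  assumes "length xs \<ge> 2"
  obtains i where "i < length xs" "i \<noteq> c" "xs ! i \<le> sort xs ! 1"
proof -
  obtain p where p: "p permutes {..<length xs}" "\<And>i. i < length xs \<Longrightarrow> sort xs ! i = xs ! p i"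
    using sort_nth_permutes by blast
  have 01: "0 < length xs" "1 < length xs" using assms by auto
  then have lt: "p 0 < length xs" "p 1 < length xs"
    using permutes_in_image[OF p(1), of 0] permutes_in_image[OF p(1), of 1] by blast+
  have eq: "sort xs ! 0 = xs ! p 0" "sort xs ! 1 = xs ! p 1" using p(2) 01 by blast+
  have "sort xs ! 0 \<le> sort xs ! 1"
    using assms by (intro sorted_nth_mono) auto
  then have le: "xs ! p 0 \<le> sort xs ! 1" "xs ! p 1 \<le> sort xs ! 1"
    unfolding eq by simp_all
  have "p 0 \<noteq> p 1" using p(1) by (metis permutes_inj injD zero_neq_one)
  then have "p 0 \<noteq> c \<or> p 1 \<noteq> c" by auto
  then show thesis using that[OF lt(1) _ le(1)] that[OF lt(2) _ le(2)] by (elim disjE)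
qed

text \<open>Applied to two honest sensors, this bounds the delay whatever the compromised sensor does.\<close>
lemma second_alarm_le_max:
  assumes "i \<in> {1..N}" "j \<in> {1..N}" "i \<noteq> j"
  shows "second_alarm N \<mu> h x \<le> max (alarm \<mu> h (x i)) (alarm \<mu> h (x j))"
proof -
  let ?xs = "map (\<lambda>n. alarm \<mu> h (x n)) [1..<N + 1]"
  have "sort ?xs ! 1 \<le> max (?xs ! (i - 1)) (?xs ! (j - 1))"
    using assms by (intro sort_nth_1_le_max) auto
  also have "\<dots> = max (alarm \<mu> h (x i)) (alarm \<mu> h (x j))"
    using assms by (subst (1 2) nth_map) (auto simp del: upt_Suc)
  finally show ?thesis unfolding second_alarm_def .
qed

text \<open>Applied to the compromised sensor \<open>c\<close>: a false second alarm needs the false alarm of an honest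
  sensor.\<close>
lemma alarm_le_second_alarm:
  assumes "N \<ge> 2"
  obtains n where "n \<in> {1..N}" "n \<noteq> c" "alarm \<mu> h (x n) \<le> second_alarm N \<mu> h x"
proof -
  let ?xs = "map (\<lambda>n. alarm \<mu> h (x n)) [1..<N + 1]"
  obtain i where "i < length ?xs" "i \<noteq> c - 1" "?xs ! i \<le> sort ?xs ! 1"
    using assms nth_le_sort_nth_1[of ?xs "c - 1"] by auto
  moreover have "?xs ! i = alarm \<mu> h (x (Suc i))"
    using calculation(1) by (subst nth_map) (auto simp del: upt_Suc)
  ultimately show thesis
    using that[of "Suc i"] unfolding second_alarm_def by (auto simp del: upt_Suc)
qed

section \<open>CUSUM on a grid\<close>

text \<open>The Lindley recursion of the CUSUM statistic, for a log-likelihood path \<open>l\<close> sampled on a grid.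
  Its \<open>k\<close>-th value is the maximum of \<open>l k - l j\<close> over \<open>j \<le> k\<close>, which is the content of the next
  three lemmas; the recursive form is the one on which one-step estimates work.\<close>
primrec grid_cusum :: "(nat \<Rightarrow> real) \<Rightarrow> nat \<Rightarrow> real" where
  "grid_cusum l 0 = 0"
| "grid_cusum l (Suc k) = max 0 (grid_cusum l k + (l (Suc k) - l k))"

lemma grid_cusum_nonneg: "grid_cusum l k \<ge> 0"
  by (cases k) auto

lemma grid_cusum_ge: "j \<le> k \<Longrightarrow> l k - l j \<le> grid_cusum l k"
proof (induction k)
  case (Suc k)
  then show ?case by (cases "j = Suc k") (auto simp: max_def)
qed auto

lemma grid_cusum_attained: "\<exists>j\<le>k. grid_cusum l k = l k - l j"
proof (induction k)
  case (Suc k)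
  then obtain j where j: "j \<le> k" "grid_cusum l k = l k - l j" by blast
  show ?case
  proof (cases "l (Suc k) - l j \<le> 0")
    case True then show ?thesis using j by (intro exI[of _ "Suc k"]) auto
  next
    case False then show ?thesis using j by (intro exI[of _ j]) auto
  qed
qed auto

text \<open>Stopping at the first failure of \<open>P\<close>, pathwise. The stopping index \<open>r\<close> is chosen before \<open>f\<close>, so
  that the statistics of several sensors can be stopped at the same time.\<close>
lemma telescope_until:
  fixes P :: "nat \<Rightarrow> bool"
  assumes "\<And>i j. i \<le> j \<Longrightarrow> P j \<Longrightarrow> P i"
  obtains r where "r \<le> K" "\<And>k. k < r \<Longrightarrow> P k" "P K \<or> \<not> P r"
    "\<And>f :: nat \<Rightarrow> real. (\<Sum>k<K. of_bool (P k) * (f (Suc k) - f k)) = f r - f 0"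
proof -
  have "\<exists>r\<le>K. (\<forall>k<r. P k) \<and> (r < K \<longrightarrow> \<not> P r) \<and>
    (\<forall>f :: nat \<Rightarrow> real. (\<Sum>k<K. of_bool (P k) * (f (Suc k) - f k)) = f r - f 0)"
  proof (induction K)
    case (Suc K)
    then obtain r where r: "r \<le> K" "\<forall>k<r. P k" "r < K \<longrightarrow> \<not> P r"
      "\<forall>f :: nat \<Rightarrow> real. (\<Sum>k<K. of_bool (P k) * (f (Suc k) - f k)) = f r - f 0" by blast
    show ?case
    proof (cases "P K")
      case True
      then have "r = K" using r assms[of r K] by (metis le_neq_implies_less nat_less_le)
      then show ?thesis using r True by (intro exI[of _ "Suc K"]) (auto simp: less_Suc_eq)
    next
      case False
      then show ?thesis using r by (intro exI[of _ r]) (auto simp: less_Suc_eq)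
    qed
  qed auto
  then show thesis using that by (metis le_neq_implies_less)
qed

section \<open>Gaussian increments\<close>

text \<open>Exponential tilting shifts a normal density.\<close>
lemma normal_density_times_exp:
  assumes "s > 0"
  shows "normal_density m s x * exp (\<theta> * x) =
    exp (\<theta> * m + \<theta>\<^sup>2 * s\<^sup>2 / 2) * normal_density (m + \<theta> * s\<^sup>2) s x"
proof -
  have "-(x - m)\<^sup>2 / (2 * s\<^sup>2) + \<theta> * x =
      (\<theta> * m + \<theta>\<^sup>2 * s\<^sup>2 / 2) + -(x - (m + \<theta> * s\<^sup>2))\<^sup>2 / (2 * s\<^sup>2)"
    using assms by (simp add: field_simps power2_eq_square)
  from arg_cong[OF this, of exp] show ?thesis
    unfolding normal_density_def exp_add by simp
qed

lemma (in prob_space) normal_mgf: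
  assumes "s > 0" and D: "distributed M lborel X (normal_density m s)"
  shows "integrable M (\<lambda>\<omega>. exp (\<theta> * X \<omega>))"
    and "expectation (\<lambda>\<omega>. exp (\<theta> * X \<omega>)) = exp (\<theta> * m + \<theta>\<^sup>2 * s\<^sup>2 / 2)"
proof -
  have eq: "(\<lambda>x. normal_density m s x * exp (\<theta> * x)) =
      (\<lambda>x. exp (\<theta> * m + \<theta>\<^sup>2 * s\<^sup>2 / 2) * normal_density (m + \<theta> * s\<^sup>2) s x)"
    using normal_density_times_exp[OF assms(1)] by blast
  have g: "(\<lambda>x. exp (\<theta> * x)) \<in> borel_measurable lborel" by measurable
  show "integrable M (\<lambda>\<omega>. exp (\<theta> * X \<omega>))"
    using distributed_integrable[OF D g] assms(1) unfolding eq by simp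
  show "expectation (\<lambda>\<omega>. exp (\<theta> * X \<omega>)) = exp (\<theta> * m + \<theta>\<^sup>2 * s\<^sup>2 / 2)"
    using distributed_integral[OF D g] assms(1) unfolding eq by simp
qed

lemma (in prob_space) normal_integrable:
  assumes "s > 0" and D: "distributed M lborel X (normal_density m s)"
  shows "integrable M X"
  using distributed_integrable[OF D, of "\<lambda>x. x"] integrable_normal_moment_nz_1[OF assms(1)] by simp

text \<open>The log-likelihood paths \<open>l n\<close> of some honest sensors, seen on a grid. The \<open>\<sigma>\<close>-algebra \<open>F k\<close> stands
  for everything reported up to the \<open>k\<close>-th grid time, including what the compromised sensor
  reports. The definition of an attack enters through \<open>fresh\<close>.

  In the two applications \<open>s\<^sup>2 = 2 * m\<close> (after the change) or \<open>s\<^sup>2 = - 2 * m\<close> (no change), so that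
  \<open>exp (- X)\<close> respectively \<open>exp X\<close> has mean 1: it is a likelihood ratio.\<close>
locale gaussian_walks = prob_space M for M :: "'a measure" +
  fixes F :: "nat \<Rightarrow> 'a measure" and I :: "'n set" and l :: "'n \<Rightarrow> nat \<Rightarrow> 'a \<Rightarrow> real"
    and m s :: real
  assumes finite_I: "finite I" and s_pos: "s > 0"
    and subalgebra: "subalgebra M (F k)"
    and filtration: "subalgebra (F (Suc k)) (F k)"
    and adapted: "n \<in> I \<Longrightarrow> l n k \<in> borel_measurable (F k)"
    and gaussian: "n \<in> I \<Longrightarrow>
      distributed M lborel (\<lambda>\<omega>. l n (Suc k) \<omega> - l n k \<omega>) (normal_density m s)"
    and fresh: "n \<in> I \<Longrightarrow> indep_set (sets (F k))
      (sets (vimage_algebra (space M) (\<lambda>\<omega>. l n (Suc k) \<omega> - l n k \<omega>) borel))"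
begin

abbreviation X :: "'n \<Rightarrow> nat \<Rightarrow> 'a \<Rightarrow> real" where
  "X n k \<omega> \<equiv> l n (Suc k) \<omega> - l n k \<omega>"

abbreviation Y :: "'n \<Rightarrow> nat \<Rightarrow> 'a \<Rightarrow> real" where
  "Y n k \<omega> \<equiv> grid_cusum (\<lambda>j. l n j \<omega>) k"

text \<open>No grid CUSUM has reached \<open>h\<close> by time \<open>k\<close>. Since \<open>quiet\<close> fails for good once it fails, the sum
  over \<open>k\<close> of its indicators is the first alarm time. The event \<open>A\<close> is where a conditional
  expectation given \<open>F 0\<close> is going to be tested.\<close>
definition quiet :: "'a set \<Rightarrow> real \<Rightarrow> nat \<Rightarrow> 'a set" where
  "quiet A h k = {\<omega>\<in>A. \<forall>n\<in>I. \<forall>j\<le>k. Y n j \<omega> < h}"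

lemma filtration_le: "i \<le> j \<Longrightarrow> subalgebra (F j) (F i)"
proof (induction j)
  case (Suc j)
  then show ?case using filtration[of j] by (cases "i = Suc j") (auto simp: subalgebra_def)
qed (auto simp: subalgebra_def)

lemma space_F: "space (F k) = space M"
  using subalgebra[of k] by (simp add: subalgebra_def)

lemma cusum_adapted: "n \<in> I \<Longrightarrow> j \<le> k \<Longrightarrow> Y n j \<in> borel_measurable (F k)"
proof (induction j arbitrary: k)
  case (Suc j)
  have [measurable]: "l n (Suc j) \<in> borel_measurable (F k)" "l n j \<in> borel_measurable (F k)"
    using adapted[OF Suc.prems(1)] filtration_le Suc.prems(2)
    by (meson measurable_from_subalg Suc_leD)+
  have [measurable]: "Y n j \<in> borel_measurable (F k)" using Suc by simp
  show ?case by simp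
qed simp

lemma quiet_sets:
  assumes "A \<in> sets (F 0)"
  shows "quiet A h k \<in> sets (F k)"
proof -
  have [measurable]: "A \<in> sets (F k)" using assms filtration_le[of 0 k] by (auto simp: subalgebra_def)
  have "{\<omega>\<in>space (F k). \<forall>n\<in>I. \<forall>j\<in>{..k}. Y n j \<omega> < h} \<in> sets (F k)"
    using cusum_adapted finite_I
    by (intro sets.sets_Collect_finite_All predE) (auto intro!: borel_measurable_less)
  moreover have "quiet A h k = A \<inter> {\<omega>\<in>space (F k). \<forall>n\<in>I. \<forall>j\<in>{..k}. Y n j \<omega> < h}"
    using sets.sets_into_space[of A "F k"] by (auto simp: quiet_def)
  ultimately show ?thesis by simp
qed

lemma quiet_measurable [measurable]: "A \<in> sets (F 0) \<Longrightarrow> quiet A h k \<in> sets M"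
  using quiet_sets[of A h k] subalgebra[of k] by (auto simp: subalgebra_def)

lemma quiet_antimono: "i \<le> j \<Longrightarrow> quiet A h j \<subseteq> quiet A h i"
  by (auto simp: quiet_def)

text \<open>The form in which \<open>fresh\<close> is used: a bounded function of the past factors out.\<close>
lemma fresh_expectation:
  fixes Z :: "'a \<Rightarrow> real"
  assumes "n \<in> I" and Z: "Z \<in> borel_measurable (F k)" and bd: "\<And>\<omega>. \<bar>Z \<omega>\<bar> \<le> C"
    and g: "g \<in> borel_measurable borel" "integrable M (\<lambda>\<omega>. g (X n k \<omega>))"
  shows "integrable M (\<lambda>\<omega>. Z \<omega> * g (X n k \<omega>))"
    and "expectation (\<lambda>\<omega>. Z \<omega> * g (X n k \<omega>)) = expectation Z * expectation (\<lambda>\<omega>. g (X n k \<omega>))"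
proof -
  have ZM [measurable]: "Z \<in> borel_measurable M"
    using Z measurable_from_subalg[OF subalgebra] by blast
  have XM [measurable]: "X n k \<in> borel_measurable M"
    using gaussian[OF assms(1)] by (auto simp: distributed_def)
  note [measurable] = g(1)
  let ?V = "vimage_algebra (space M) (X n k) borel"
  have gV: "(\<lambda>\<omega>. g (X n k \<omega>)) \<in> borel_measurable ?V"
    by (rule measurable_compose[OF measurable_vimage_algebra1 g(1)]) auto
  have "indep_set
      (sigma_sets (space M) {Z -` A \<inter> space M |A. A \<in> sets borel})
      (sigma_sets (space M) {(\<lambda>\<omega>. g (X n k \<omega>)) -` A \<inter> space M |A. A \<in> sets borel})"
    using fresh[OF assms(1), of k] unfolding indep_set_def
  proof (rule indep_sets_mono_sets)
    fix i :: bool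
    have "sigma_sets (space M) {Z -` A \<inter> space M |A. A \<in> sets borel} \<subseteq> sets (F k)"
      using measurable_sets[OF Z] by (intro sets.sigma_sets_subset[of _ "F k", unfolded space_F]) (auto simp: space_F)
    moreover have "sigma_sets (space M) {(\<lambda>\<omega>. g (X n k \<omega>)) -` A \<inter> space M |A. A \<in> sets borel} \<subseteq> sets ?V"
      using measurable_sets[OF gV] by (intro sets.sigma_sets_subset[of _ ?V, simplified]) auto
    ultimately show "(case i of True \<Rightarrow> sigma_sets (space M) {Z -` A \<inter> space M |A. A \<in> sets borel}
           | False \<Rightarrow> sigma_sets (space M) {(\<lambda>\<omega>. g (X n k \<omega>)) -` A \<inter> space M |A. A \<in> sets borel})
         \<subseteq> (case i of True \<Rightarrow> sets (F k) | False \<Rightarrow> sets ?V)"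
      by (cases i) auto
  qed
  then have ind: "indep_var borel Z borel (\<lambda>\<omega>. g (X n k \<omega>))"
    unfolding indep_var_eq by (intro conjI) measurable
  have "integrable M Z" by (rule integrable_const_bound[of _ C]) (auto simp: bd)
  from indep_var_integrable[OF ind this g(2)] indep_var_lebesgue_integral[OF ind this g(2)]
  show "integrable M (\<lambda>\<omega>. Z \<omega> * g (X n k \<omega>))"
    "expectation (\<lambda>\<omega>. Z \<omega> * g (X n k \<omega>)) = expectation Z * expectation (\<lambda>\<omega>. g (X n k \<omega>))" by auto
qed

lemma fresh_exp:
  fixes Z :: "'a \<Rightarrow> real"
  assumes "n \<in> I" "Z \<in> borel_measurable (F k)" "\<And>\<omega>. \<bar>Z \<omega>\<bar> \<le> C"
  shows "integrable M (\<lambda>\<omega>. Z \<omega> * exp (\<theta> * X n k \<omega>))"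
    and "expectation (\<lambda>\<omega>. Z \<omega> * exp (\<theta> * X n k \<omega>)) = expectation Z * exp (\<theta> * m + \<theta>\<^sup>2 * s\<^sup>2 / 2)"
proof -
  note D = gaussian[OF assms(1), of k]
  have g: "(\<lambda>x. exp (\<theta> * x)) \<in> borel_measurable borel" by measurable
  show "integrable M (\<lambda>\<omega>. Z \<omega> * exp (\<theta> * X n k \<omega>))"
    by (rule fresh_expectation(1)[OF assms g normal_mgf(1)[OF s_pos D]])
  show "expectation (\<lambda>\<omega>. Z \<omega> * exp (\<theta> * X n k \<omega>)) = expectation Z * exp (\<theta> * m + \<theta>\<^sup>2 * s\<^sup>2 / 2)"
    by (simp only: fresh_expectation(2)[OF assms g normal_mgf(1)[OF s_pos D]] normal_mgf(2)[OF s_pos D])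
qed

lemma fresh_linear:
  fixes Z :: "'a \<Rightarrow> real"
  assumes "n \<in> I" "Z \<in> borel_measurable (F k)" "\<And>\<omega>. \<bar>Z \<omega>\<bar> \<le> C"
  shows "integrable M (\<lambda>\<omega>. Z \<omega> * X n k \<omega>)"
    and "expectation (\<lambda>\<omega>. Z \<omega> * X n k \<omega>) = expectation Z * m"
proof -
  note D = gaussian[OF assms(1), of k]
  have g: "(\<lambda>x :: real. x) \<in> borel_measurable borel" by measurable
  show "integrable M (\<lambda>\<omega>. Z \<omega> * X n k \<omega>)"
    by (rule fresh_expectation(1)[OF assms g normal_integrable[OF s_pos D]])
  show "expectation (\<lambda>\<omega>. Z \<omega> * X n k \<omega>) = expectation Z * m"
    by (simp only: fresh_expectation(2)[OF assms g normal_integrable[OF s_pos D]]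
          normal_distributed_expectation[OF s_pos D])
qed

end

section \<open>Two potential functions\<close>

text \<open>The functions \<open>u + exp (- u)\<close> and \<open>exp u - u\<close> solve \<open>f'' + f' = 1\<close> and \<open>f'' - f' = 1\<close> with
  \<open>f' 0 = 0\<close>, i.e. they turn the CUSUM process with and without change into a process that grows
  at a constant mean rate.\<close>

lemma mono_add_exp_minus:
  fixes u v :: real
  assumes "0 \<le> u" "u \<le> v"
  shows "u + exp (- u) \<le> v + exp (- v)"
proof -
  have "exp (- u) - exp (- v) = exp (- u) * (1 - exp (- (v - u)))"
    by (simp add: right_diff_distrib flip: exp_add)
  also have "\<dots> \<le> 1 * (v - u)"
    using assms exp_ge_add_one_self[of "- (v - u)"]
    by (intro mult_mono) (auto simp del: exp_ge_add_one_self)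
  finally show ?thesis by simp
qed

lemma mono_exp_minus_id:
  fixes u v :: real
  assumes "0 \<le> u" "u \<le> v"
  shows "exp u - u \<le> exp v - v"
proof -
  have "1 * (v - u) \<le> exp u * (exp (v - u) - 1)"
    using assms exp_ge_add_one_self[of "v - u"] by (intro mult_mono) (auto simp del: exp_ge_add_one_self)
  also have "\<dots> = exp v - exp u" by (simp add: algebra_simps flip: exp_add)
  finally show ?thesis by simp
qed

text \<open>Cutting at 0 is the reflection in the CUSUM recursion; cutting at \<open>a\<close> makes a potential function
  bounded, so that neither integrability nor the overshoot over the threshold is an issue.\<close>
definition clamp_to :: "real \<Rightarrow> real \<Rightarrow> real" where
  "clamp_to a z = min (max z 0) a"

text \<open>Since \<open>exp z - z\<close> is smallest at 0, cutting can only lower it. This is the favourable direction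
  for a lower bound on the run length.\<close>
lemma exp_clamp_le:
  assumes "0 < h"
  shows "exp (clamp_to h z) - clamp_to h z \<le> exp z - z"
proof -
  have "exp (0::real) - 0 \<le> exp z - z" using exp_ge_add_one_self[of z] by (simp del: exp_ge_add_one_self)
  then show ?thesis
    using mono_exp_minus_id[of h z] assms by (auto simp: clamp_to_def min_def max_def)
qed

text \<open>For an upper bound on the delay, cutting must not lower the potential. As \<open>u + exp (- u)\<close> is also
  smallest at 0, it is evaluated at \<open>u = b + z\<close>: it is then increasing for \<open>z \<ge> - b\<close>, and so cutting
  at 0 raises it there. What is left are the steps \<open>x\<close> larger than \<open>b\<close>, below \<open>- b\<close> or above the cap
  \<open>h + b\<close>. Their contribution, at most \<open>exp \<bar>x\<bar>\<close>, is bounded by an exponential moment of order \<open>\<theta>\<close>.\<close>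
lemma exp_minus_clamp_ge:
  assumes "0 \<le> y" "y < h" "0 < b" "1 \<le> \<theta>"
  shows "b + (y + x) + exp (- (b + (y + x))) - exp (b - \<theta> * b) * (exp (\<theta> * x) + exp (- \<theta> * x))
     \<le> b + clamp_to (h + b) (y + x) + exp (- (b + clamp_to (h + b) (y + x)))"
proof -
  define z where "z = y + x"
  have pos: "0 \<le> exp (b - \<theta> * b) * (exp (\<theta> * x) + exp (- \<theta> * x))" by simp
  show ?thesis
  proof (cases "-b \<le> z \<and> z \<le> h + b")
    case True
    then have "b + z + exp (- (b + z)) \<le> b + clamp_to (h + b) z + exp (- (b + clamp_to (h + b) z))"
      using assms by (intro mono_add_exp_minus) (auto simp: clamp_to_def)
    with pos show ?thesis unfolding z_def by linarith
  next
    case False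
    then have xb: "b < \<bar>x\<bar>" using assms unfolding z_def by linarith
    have "\<bar>x\<bar> \<le> (b - \<theta> * b) + \<theta> * \<bar>x\<bar>"
      using mult_left_mono[of b "\<bar>x\<bar>" "\<theta> - 1"] xb assms by (simp add: algebra_simps)
    then have "exp \<bar>x\<bar> \<le> exp (b - \<theta> * b) * exp (\<theta> * \<bar>x\<bar>)"
      by (simp flip: exp_add)
    also have "\<dots> \<le> exp (b - \<theta> * b) * (exp (\<theta> * x) + exp (- \<theta> * x))"
      by (intro mult_left_mono) (auto simp: abs_if)
    finally have big: "exp \<bar>x\<bar> \<le> exp (b - \<theta> * b) * (exp (\<theta> * x) + exp (- \<theta> * x))" .
    show ?thesis
    proof (cases "z < -b")
      case True
      then have "exp (- (b + z)) \<le> exp \<bar>x\<bar>" using assms by (simp add: z_def)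
      note order_trans[OF this big]
      moreover have c: "clamp_to (h + b) z = 0" using True assms by (simp add: clamp_to_def)
      moreover have "0 < exp (- (b + 0 :: real))" by simp
      ultimately show ?thesis using True assms(3) unfolding z_def[symmetric] c by linarith
    next
      case 2: False
      with False have zb: "z > h + b" by auto
      then have c: "clamp_to (h + b) z = h + b" using assms by (simp add: clamp_to_def)
      have "exp (- (b + z)) \<le> exp (- (b + (h + b)))" using zb by simp
      moreover have "z - (h + b) \<le> 1 + \<bar>x\<bar>" using assms by (simp add: z_def)
      note order_trans[OF order_trans[OF this exp_ge_add_one_self] big]
      ultimately show ?thesis unfolding z_def[symmetric] c by linarith
    qed
  qed
qed

lemma clamped_exp_bounds:
  assumes "0 < h"
  shows "1 \<le> exp (clamp_to h y) - clamp_to h y" "exp (clamp_to h y) - clamp_to h y \<le> exp h - h"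
  using mono_exp_minus_id[of 0 "clamp_to h y"] mono_exp_minus_id[of "clamp_to h y" h] assms
  by (auto simp: clamp_to_def)

lemma clamped_exp_minus_bounds:
  assumes "0 < h" "0 < b"
  shows "b + exp (- b) \<le> b + clamp_to (h + b) y + exp (- (b + clamp_to (h + b) y))"
    "b + clamp_to (h + b) y + exp (- (b + clamp_to (h + b) y)) \<le> h + 2 * b + exp (- (h + 2 * b))"
  using mono_add_exp_minus[of b "b + clamp_to (h + b) y"]
    mono_add_exp_minus[of "b + clamp_to (h + b) y" "h + 2 * b"] assms
  by (auto simp: clamp_to_def)

lemma clamped_exp_measurable:
  "(\<lambda>y. exp (clamp_to h y) - clamp_to h y) \<in> borel_measurable borel"
  unfolding clamp_to_def by measurable

lemma clamped_exp_minus_measurable: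
  "(\<lambda>y. b + clamp_to (h + b) y + exp (- (b + clamp_to (h + b) y))) \<in> borel_measurable borel"
  unfolding clamp_to_def by measurable

section \<open>Mean time without alarm\<close>

context gaussian_walks
begin

lemma Y_bounds: "\<omega> \<in> quiet A h k \<Longrightarrow> n \<in> I \<Longrightarrow> 0 \<le> Y n k \<omega> \<and> Y n k \<omega> < h"
  by (auto simp: quiet_def grid_cusum_nonneg)

lemma clamp_Suc: "clamp_to a (Y n (Suc k) \<omega>) = clamp_to a (Y n k \<omega> + X n k \<omega>)"
  by (simp add: clamp_to_def max_def)

lemma step_integrable:
  fixes \<phi> :: "real \<Rightarrow> real"
  assumes A: "A \<in> sets (F 0)" and n: "n \<in> I" and \<phi>: "\<phi> \<in> borel_measurable borel"
    and bounds: "\<And>y. a \<le> \<phi> y" "\<And>y. \<phi> y \<le> b"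
  shows "integrable M (\<lambda>\<omega>. indicator (quiet A h k) \<omega> * (\<phi> (Y n (Suc k) \<omega>) - \<phi> (Y n k \<omega>)))"
proof (rule integrable_const_bound[of _ "b - a"])
  have [measurable]: "Y n j \<in> borel_measurable M" for j
    using measurable_from_subalg[OF subalgebra cusum_adapted[OF n order_refl]] .
  note [measurable] = quiet_measurable[OF A, of h k] \<phi>
  show "(\<lambda>\<omega>. indicator (quiet A h k) \<omega> * (\<phi> (Y n (Suc k) \<omega>) - \<phi> (Y n k \<omega>))) \<in> borel_measurable M"
    by (simp del: grid_cusum.simps)
  have "\<bar>\<phi> x - \<phi> y\<bar> \<le> b - a" "0 \<le> b - a" for x y
    using bounds[of x] bounds[of y] by linarith+
  then show "AE \<omega> in M. norm (indicator (quiet A h k) \<omega> * (\<phi> (Y n (Suc k) \<omega>) - \<phi> (Y n k \<omega>))) \<le> b - a"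
    by (simp add: indicator_def del: grid_cusum.simps)
qed

lemma quiet_indicator_measurable:
  assumes "A \<in> sets (F 0)" "n \<in> I" "f \<in> borel_measurable borel"
  shows "(\<lambda>\<omega>. indicator (quiet A h k) \<omega> * f (Y n k \<omega>) :: real) \<in> borel_measurable (F k)"
proof -
  note [measurable] = quiet_sets[OF assms(1)] cusum_adapted[OF assms(2), of k k] assms(3)
  show ?thesis by measurable
qed

text \<open>One step of \<open>exp Y - Y\<close>: with \<open>exp X\<close> of mean 1, the term \<open>exp Y\<close> stays the same in mean, and \<open>- Y\<close>
  gains \<open>- m\<close>.\<close>
lemma step_below_drift:
  assumes n: "n \<in> I" and s: "s\<^sup>2 = - 2 * m" and h: "0 < h" and A: "A \<in> sets (F 0)"
  defines "\<phi> \<equiv> (\<lambda>y. exp (clamp_to h y) - clamp_to h y)"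
  shows "expectation (\<lambda>\<omega>. indicator (quiet A h k) \<omega> * (\<phi> (Y n (Suc k) \<omega>) - \<phi> (Y n k \<omega>)))
    \<le> - m * prob (quiet A h k)"
proof -
  let ?B = "quiet A h k"
  define Z where "Z = (\<lambda>\<omega>. indicator ?B \<omega> * exp (Y n k \<omega>))"
  have Z: "Z \<in> borel_measurable (F k)" "\<And>\<omega>. \<bar>Z \<omega>\<bar> \<le> exp h"
    using quiet_indicator_measurable[OF A n, of exp h k] Y_bounds[OF _ n]
    by (force simp: Z_def indicator_def)+
  have B: "indicator ?B \<in> borel_measurable (F k)" "\<And>\<omega>. \<bar>indicator ?B \<omega> :: real\<bar> \<le> 1"
    using quiet_sets[OF A] by (auto simp: indicator_def)
  note int = fresh_exp[OF n Z, of 1] fresh_linear[OF n B]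
  have ZM: "integrable M Z"
    using Z measurable_from_subalg[OF subalgebra Z(1)] by (intro integrable_const_bound[of _ "exp h"]) auto
  have "expectation (\<lambda>\<omega>. indicator ?B \<omega> * (\<phi> (Y n (Suc k) \<omega>) - \<phi> (Y n k \<omega>)))
      \<le> expectation (\<lambda>\<omega>. Z \<omega> * exp (1 * X n k \<omega>) - Z \<omega> - indicator ?B \<omega> * X n k \<omega>)"
  proof (rule integral_mono)
    show "integrable M (\<lambda>\<omega>. indicator ?B \<omega> * (\<phi> (Y n (Suc k) \<omega>) - \<phi> (Y n k \<omega>)))"
      unfolding \<phi>_def by (rule step_integrable[OF A n clamped_exp_measurable clamped_exp_bounds[OF h]])
    show "integrable M (\<lambda>\<omega>. Z \<omega> * exp (1 * X n k \<omega>) - Z \<omega> - indicator ?B \<omega> * X n k \<omega>)"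
      using int ZM by auto
    fix \<omega> assume "\<omega> \<in> space M"
    show "indicator ?B \<omega> * (\<phi> (Y n (Suc k) \<omega>) - \<phi> (Y n k \<omega>))
      \<le> Z \<omega> * exp (1 * X n k \<omega>) - Z \<omega> - indicator ?B \<omega> * X n k \<omega>"
    proof (cases "\<omega> \<in> ?B")
      case True
      have "\<phi> (Y n (Suc k) \<omega>) \<le> exp (Y n k \<omega> + X n k \<omega>) - (Y n k \<omega> + X n k \<omega>)"
        unfolding \<phi>_def clamp_Suc by (rule exp_clamp_le[OF h])
      moreover have "\<phi> (Y n k \<omega>) = exp (Y n k \<omega>) - Y n k \<omega>"
        using Y_bounds[OF True n] by (simp add: \<phi>_def clamp_to_def)
      ultimately show ?thesis using True by (simp add: Z_def exp_add del: grid_cusum.simps)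
    qed (simp add: Z_def)
  qed
  also have "\<dots> = expectation Z * exp (1 * m + 1\<^sup>2 * s\<^sup>2 / 2) - expectation Z - expectation (indicator ?B) * m"
    using int ZM by simp
  also have "\<dots> = - m * prob ?B"
    using quiet_measurable[OF A, of h k] by (simp add: s)
  finally show ?thesis .
qed

text \<open>One step of \<open>u + exp (- u)\<close> at \<open>u = b + Y\<close>: with \<open>exp (- X)\<close> of mean 1, only the linear term moves.
  The loss \<open>\<eta>\<close> is the mean of the error term of \<open>exp_minus_clamp_ge\<close>.\<close>
lemma step_above_drift:
  assumes n: "n \<in> I" and s: "s\<^sup>2 = 2 * m" and h: "0 < h" and b: "0 < b" and \<theta>: "1 \<le> \<theta>"
    and A: "A \<in> sets (F 0)"
  defines "\<phi> \<equiv> (\<lambda>y. b + clamp_to (h + b) y + exp (- (b + clamp_to (h + b) y)))"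
    and "\<eta> \<equiv> exp (b - \<theta> * b) * (exp (\<theta> * m + \<theta>\<^sup>2 * m) + exp (- \<theta> * m + \<theta>\<^sup>2 * m))"
  shows "(m - \<eta>) * prob (quiet A h k)
    \<le> expectation (\<lambda>\<omega>. indicator (quiet A h k) \<omega> * (\<phi> (Y n (Suc k) \<omega>) - \<phi> (Y n k \<omega>)))"
proof -
  let ?B = "quiet A h k" and ?c = "exp (b - \<theta> * b)"
  define Z where "Z = (\<lambda>\<omega>. indicator ?B \<omega> * exp (- (b + Y n k \<omega>)))"
  have Z: "Z \<in> borel_measurable (F k)" "\<And>\<omega>. \<bar>Z \<omega>\<bar> \<le> 1"
    using quiet_indicator_measurable[OF A n, of "\<lambda>y. exp (- (b + y))" h k] Y_bounds[OF _ n] b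
    by (force simp: Z_def indicator_def)+
  have B: "indicator ?B \<in> borel_measurable (F k)" "\<And>\<omega>. \<bar>indicator ?B \<omega> :: real\<bar> \<le> 1"
    using quiet_sets[OF A] by (auto simp: indicator_def)
  note int = fresh_exp[OF n Z, of "-1"] fresh_linear[OF n B] fresh_exp[OF n B, of \<theta>] fresh_exp[OF n B, of "-\<theta>"]
  have ZM: "integrable M Z"
    using Z measurable_from_subalg[OF subalgebra Z(1)] by (intro integrable_const_bound[of _ 1]) auto
  let ?R = "\<lambda>\<omega>. Z \<omega> * exp (-1 * X n k \<omega>) - Z \<omega> + indicator ?B \<omega> * X n k \<omega>
      - ?c * (indicator ?B \<omega> * exp (\<theta> * X n k \<omega>)) - ?c * (indicator ?B \<omega> * exp (- \<theta> * X n k \<omega>))"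
  have "(m - \<eta>) * prob ?B =
    expectation Z * exp (-1 * m + (-1)\<^sup>2 * s\<^sup>2 / 2) - expectation Z + expectation (indicator ?B) * m
    - ?c * (expectation (indicator ?B) * exp (\<theta> * m + \<theta>\<^sup>2 * s\<^sup>2 / 2))
    - ?c * (expectation (indicator ?B) * exp (- \<theta> * m + (-\<theta>)\<^sup>2 * s\<^sup>2 / 2))"
    using quiet_measurable[OF A, of h k] by (simp add: s \<eta>_def algebra_simps)
  also have "\<dots> = expectation ?R"
    using int ZM by simp
  also have "\<dots> \<le> expectation (\<lambda>\<omega>. indicator ?B \<omega> * (\<phi> (Y n (Suc k) \<omega>) - \<phi> (Y n k \<omega>)))"
  proof (rule integral_mono)
    show "integrable M (\<lambda>\<omega>. indicator ?B \<omega> * (\<phi> (Y n (Suc k) \<omega>) - \<phi> (Y n k \<omega>)))"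
      unfolding \<phi>_def
      by (rule step_integrable[OF A n clamped_exp_minus_measurable clamped_exp_minus_bounds[OF h b]])
    show "integrable M ?R"
      using int ZM by auto
    fix \<omega> assume "\<omega> \<in> space M"
    show "?R \<omega> \<le> indicator ?B \<omega> * (\<phi> (Y n (Suc k) \<omega>) - \<phi> (Y n k \<omega>))"
    proof (cases "\<omega> \<in> ?B")
      case True
      note Y = Y_bounds[OF True n]
      have "b + (Y n k \<omega> + X n k \<omega>) + exp (- (b + (Y n k \<omega> + X n k \<omega>)))
          - ?c * (exp (\<theta> * X n k \<omega>) + exp (- \<theta> * X n k \<omega>)) \<le> \<phi> (Y n (Suc k) \<omega>)"
        unfolding \<phi>_def clamp_Suc using Y b \<theta> by (intro exp_minus_clamp_ge) auto
      moreover have "\<phi> (Y n k \<omega>) = b + Y n k \<omega> + exp (- (b + Y n k \<omega>))"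
        using Y b by (simp add: \<phi>_def clamp_to_def)
      moreover have "exp (- (b + (Y n k \<omega> + X n k \<omega>))) = exp (- (b + Y n k \<omega>)) * exp (-1 * X n k \<omega>)"
        by (simp flip: exp_add)
      ultimately show ?thesis using True by (simp add: Z_def algebra_simps del: grid_cusum.simps)
    qed (simp add: Z_def)
  qed
  finally show ?thesis .
qed

text \<open>Up to the alarm the capped potential gains at least \<open>m - \<eta>\<close> per step in mean, and in total no more
  than the difference between its largest value, at \<open>h + b\<close>, and its value at the start.\<close>
theorem quiet_time_le:
  assumes I: "I = {n}" and s: "s\<^sup>2 = 2 * m" and h: "0 < h" and b: "0 < b" and \<theta>: "1 \<le> \<theta>"
    and A: "A \<in> sets (F 0)"
  shows "(m - exp (b - \<theta> * b) * (exp (\<theta> * m + \<theta>\<^sup>2 * m) + exp (- \<theta> * m + \<theta>\<^sup>2 * m)))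
      * (\<Sum>k<K. prob (quiet A h k))
    \<le> prob A * (h + b + exp (- (h + 2 * b)) - exp (- b))"
proof -
  define \<phi> where "\<phi> = (\<lambda>y. b + clamp_to (h + b) y + exp (- (b + clamp_to (h + b) y)))"
  have n: "n \<in> I" using I by simp
  have AM [measurable]: "A \<in> sets M" using A subalgebra[of 0] by (auto simp: subalgebra_def)
  let ?f = "\<lambda>k \<omega>. indicator (quiet A h k) \<omega> * (\<phi> (Y n (Suc k) \<omega>) - \<phi> (Y n k \<omega>))"
  have \<phi>: "b + exp (- b) \<le> \<phi> y" "\<phi> y \<le> h + 2 * b + exp (- (h + 2 * b))" for y
    unfolding \<phi>_def by (rule clamped_exp_minus_bounds[OF h b])+
  have int: "integrable M (?f k)" for k
    by (rule step_integrable[OF A n clamped_exp_minus_measurable[of b h, folded \<phi>_def] \<phi>])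
  have "(m - exp (b - \<theta> * b) * (exp (\<theta> * m + \<theta>\<^sup>2 * m) + exp (- \<theta> * m + \<theta>\<^sup>2 * m)))
      * (\<Sum>k<K. prob (quiet A h k)) \<le> (\<Sum>k<K. expectation (?f k))"
    unfolding sum_distrib_left \<phi>_def by (intro sum_mono step_above_drift n s h b \<theta> A)
  also have "\<dots> = expectation (\<lambda>\<omega>. \<Sum>k<K. ?f k \<omega>)"
    by (intro Bochner_Integration.integral_sum[symmetric] int)
  also have "\<dots> \<le> expectation (\<lambda>\<omega>. indicator A \<omega> * (h + b + exp (- (h + 2 * b)) - exp (- b)))"
  proof (rule integral_mono)
    show "integrable M (\<lambda>\<omega>. \<Sum>k<K. ?f k \<omega>)"
      by (intro Bochner_Integration.integrable_sum int)
    fix \<omega> assume "\<omega> \<in> space M"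
    show "(\<Sum>k<K. ?f k \<omega>) \<le> indicator A \<omega> * (h + b + exp (- (h + 2 * b)) - exp (- b))"
    proof (cases "\<omega> \<in> A")
      case True
      obtain r where "\<And>f :: nat \<Rightarrow> real.
          (\<Sum>k<K. of_bool (\<omega> \<in> quiet A h k) * (f (Suc k) - f k)) = f r - f 0"
        by (rule telescope_until[of "\<lambda>k. \<omega> \<in> quiet A h k" K]) (use quiet_antimono in blast)+
      from this[of "\<lambda>k. \<phi> (Y n k \<omega>)"]
      have "(\<Sum>k<K. ?f k \<omega>) = \<phi> (Y n r \<omega>) - \<phi> (Y n 0 \<omega>)"
        by (simp only: indicator_def of_bool_def)
      also have "\<phi> (Y n 0 \<omega>) = b + exp (- b)" using h b by (simp add: \<phi>_def clamp_to_def)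
      finally show ?thesis using \<phi>(2)[of "Y n r \<omega>"] True by simp
    next
      case False
      then have "\<omega> \<notin> quiet A h k" for k by (simp add: quiet_def)
      then show ?thesis using False by simp
    qed
  next
    show "integrable M (\<lambda>\<omega>. indicator A \<omega> * (h + b + exp (- (h + 2 * b)) - exp (- b)))"
      by (intro integrable_mult_left integrable_real_indicator AM) (simp add: less_top[symmetric])
  qed
  also have "\<dots> = prob A * (h + b + exp (- (h + 2 * b)) - exp (- b))" by simp
  finally show ?thesis .
qed

text \<open>In particular, the alarm time has finite mean on \<open>A\<close>.\<close>
corollary nn_quiet_time_le:
  assumes I: "I = {n}" and s: "s\<^sup>2 = 2 * m" and h: "0 < h" and b: "0 < b" and \<theta>: "1 \<le> \<theta>"
    and A: "A \<in> sets (F 0)"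
    and \<eta>: "exp (b - \<theta> * b) * (exp (\<theta> * m + \<theta>\<^sup>2 * m) + exp (- \<theta> * m + \<theta>\<^sup>2 * m)) < m"
      (is "?\<eta> < m")
  shows "(\<integral>\<^sup>+ \<omega>. (\<Sum>k. indicator (quiet A h k) \<omega>) \<partial>M)
    \<le> ennreal (prob A * (h + b + exp (- (h + 2 * b)) - exp (- b)) / (m - ?\<eta>))"
proof -
  note [measurable] = quiet_measurable[OF A, of h]
  have "(\<integral>\<^sup>+ \<omega>. (\<Sum>k. indicator (quiet A h k) \<omega>) \<partial>M) = (\<Sum>k. emeasure M (quiet A h k))"
    by (subst nn_integral_suminf) auto
  also have "\<dots> \<le> ennreal (prob A * (h + b + exp (- (h + 2 * b)) - exp (- b)) / (m - ?\<eta>))"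
  proof (rule suminf_le_const)
    fix K
    have "(\<Sum>k<K. emeasure M (quiet A h k)) = ennreal (\<Sum>k<K. prob (quiet A h k))"
      by (simp add: emeasure_eq_measure sum_ennreal)
    also have "\<dots> \<le> ennreal (prob A * (h + b + exp (- (h + 2 * b)) - exp (- b)) / (m - ?\<eta>))"
      using quiet_time_le[OF I s h b \<theta> A, of K] \<eta>
      by (intro ennreal_leI) (simp add: pos_le_divide_eq mult.commute)
    finally show "(\<Sum>k<K. emeasure M (quiet A h k))
      \<le> ennreal (prob A * (h + b + exp (- (h + 2 * b)) - exp (- b)) / (m - ?\<eta>))" .
  qed simp
  finally show ?thesis .
qed

text \<open>The potentials \<open>exp Y - Y - 1\<close> of all sensors are added up. The sum gains at most \<open>- m\<close> per step and
  sensor, and at the first alarm one summand has reached \<open>exp h - h - 1\<close> while the others are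
  nonnegative.\<close>
theorem quiet_time_ge:
  assumes s: "s\<^sup>2 = - 2 * m" and h: "0 < h"
  shows "(exp h - h - 1) * prob (space M - quiet (space M) h K)
    \<le> card I * (- m) * (\<Sum>k<K. prob (quiet (space M) h k))"
proof -
  define \<phi> where "\<phi> = (\<lambda>y. exp (clamp_to h y) - clamp_to h y)"
  let ?A = "space M"
  have A: "?A \<in> sets (F 0)" using sets.top[of "F 0"] space_F by simp
  let ?f = "\<lambda>n k \<omega>. indicator (quiet ?A h k) \<omega> * (\<phi> (Y n (Suc k) \<omega>) - \<phi> (Y n k \<omega>))"
  have \<phi>: "1 \<le> \<phi> y" "\<phi> y \<le> exp h - h" for y
    unfolding \<phi>_def by (rule clamped_exp_bounds[OF h])+
  have int: "integrable M (?f n k)" if "n \<in> I" for k n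
    by (rule step_integrable[OF A that clamped_exp_measurable[of h, folded \<phi>_def] \<phi>])
  have "(exp h - h - 1) * prob (space M - quiet ?A h K)
      = expectation (\<lambda>\<omega>. (exp h - h - 1) * indicator (space M - quiet ?A h K) \<omega>)"
    using quiet_measurable[OF A, of h K] by (simp add: Int_absorb2)
  also have "\<dots> \<le> expectation (\<lambda>\<omega>. \<Sum>n\<in>I. \<Sum>k<K. ?f n k \<omega>)"
  proof (rule integral_mono)
    show "integrable M (\<lambda>\<omega>. (exp h - h - 1) * indicator (space M - quiet ?A h K) \<omega>)"
      using quiet_measurable[OF A, of h K]
      by (intro integrable_mult_right integrable_real_indicator) (auto simp: less_top[symmetric])
    show "integrable M (\<lambda>\<omega>. \<Sum>n\<in>I. \<Sum>k<K. ?f n k \<omega>)"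
      by (intro Bochner_Integration.integrable_sum int)
    fix \<omega> assume \<omega>: "\<omega> \<in> space M"
    obtain r where r: "r \<le> K" "\<And>k. k < r \<Longrightarrow> \<omega> \<in> quiet ?A h k"
      "\<omega> \<in> quiet ?A h K \<or> \<omega> \<notin> quiet ?A h r"
      "\<And>f :: nat \<Rightarrow> real. (\<Sum>k<K. of_bool (\<omega> \<in> quiet ?A h k) * (f (Suc k) - f k)) = f r - f 0"
      by (rule telescope_until[of "\<lambda>k. \<omega> \<in> quiet ?A h k" K]) (use quiet_antimono in blast)+
    have eq: "(\<Sum>k<K. ?f n k \<omega>) = \<phi> (Y n r \<omega>) - 1" for n
    proof -
      have "(\<Sum>k<K. ?f n k \<omega>) = \<phi> (Y n r \<omega>) - \<phi> (Y n 0 \<omega>)"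
        using r(4)[of "\<lambda>k. \<phi> (Y n k \<omega>)"] by (simp only: indicator_def of_bool_def)
      also have "\<phi> (Y n 0 \<omega>) = 1" using h by (simp add: \<phi>_def clamp_to_def)
      finally show ?thesis .
    qed
    show "(exp h - h - 1) * indicator (space M - quiet ?A h K) \<omega> \<le> (\<Sum>n\<in>I. \<Sum>k<K. ?f n k \<omega>)"
    proof (cases "\<omega> \<in> quiet ?A h K")
      case True
      then show ?thesis unfolding eq using \<phi>(1) by (simp add: sum_nonneg)
    next
      case False
      then have "\<omega> \<notin> quiet ?A h r" using r(3) by blast
      then obtain n j where nj: "n \<in> I" "j \<le> r" "h \<le> Y n j \<omega>"
        using \<omega> by (auto simp: quiet_def not_less)
      \<comment> \<open>Before \<open>r\<close> all statistics are below \<open>h\<close>.\<close>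
      have "j = r"
        using nj r(2)[of j] by (auto simp: quiet_def not_less le_less dest!: bspec[of _ _ n] spec[of _ j])
      then have "\<phi> (Y n r \<omega>) = exp h - h" using nj h by (simp add: \<phi>_def clamp_to_def)
      moreover have "\<phi> (Y n r \<omega>) - 1 \<le> (\<Sum>n\<in>I. \<phi> (Y n r \<omega>) - 1)"
        using \<phi>(1) by (intro member_le_sum finite_I nj) auto
      ultimately show ?thesis unfolding eq using False \<omega> by simp
    qed
  qed
  also have "\<dots> = (\<Sum>n\<in>I. \<Sum>k<K. expectation (?f n k))"
    by (subst Bochner_Integration.integral_sum)
       (intro Bochner_Integration.integrable_sum int sum.cong refl
          Bochner_Integration.integral_sum; assumption)+
  also have "\<dots> \<le> (\<Sum>n\<in>I. \<Sum>k<K. - m * prob (quiet ?A h k))"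
    unfolding \<phi>_def by (intro sum_mono step_below_drift s h A) auto
  also have "\<dots> = card I * (- m) * (\<Sum>k<K. prob (quiet ?A h k))"
    by (simp add: sum_distrib_left mult.assoc)
  finally show ?thesis .
qed

end

section \<open>Honest sensors\<close>

lemma space_generated_by [simp]: "space (generated_by M I X) = space M"
  unfolding generated_by_def by (rule space_measure_of) auto

lemma generated_by_measurable: "i \<in> I \<Longrightarrow> X i \<in> borel_measurable (generated_by M I X)"
proof (rule measurableI)
  fix A :: "real set" assume "i \<in> I" "A \<in> sets borel"
  then show "X i -` A \<inter> space (generated_by M I X) \<in> sets (generated_by M I X)"
    unfolding space_generated_by unfolding generated_by_def by (subst sets_measure_of) auto
qed simp

lemma sets_generated_by_subset:
  assumes "\<And>i. i \<in> I \<Longrightarrow> X i \<in> borel_measurable L" "space L = space M"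
  shows "sets (generated_by M I X) \<subseteq> sets L"
proof -
  have "sigma_sets (space L) (\<Union>i\<in>I. {X i -` A \<inter> space L |A. A \<in> sets borel}) \<subseteq> sets L"
    using assms(1) measurable_sets by (intro sets.sigma_sets_subset) blast
  then show ?thesis unfolding generated_by_def using assms(2) by (subst sets_measure_of) auto
qed

lemma space_report_filtration [simp]: "space (report_filtration M N X t) = space M"
  by (simp add: report_filtration_def)

definition loglik :: "real \<Rightarrow> (real \<Rightarrow> real) \<Rightarrow> real \<Rightarrow> real" where
  "loglik \<mu> x t = \<mu> * x t - \<mu>\<^sup>2 * t / 2"

lemma signal_no_change: "signal W \<mu> \<infinity> n t \<omega> = W n t \<omega>"
  by (simp add: signal_def)

text \<open>The definition of an attack provides exactly the independence required by the locale: the next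
  noise increment of an honest sensor is not disclosed by the reports made so far. The time grid
  starts either at the change, and then the log-likelihood has drift \<open>\<mu>\<^sup>2 / 2\<close>, or there is no change,
  and then the drift is \<open>- \<mu>\<^sup>2 / 2\<close>.\<close>
lemma gaussian_walks_honest:
  assumes \<mu>: "\<mu> \<noteq> 0" and noise: "sensor_noise M N W" and att: "attack M N W \<mu> \<tau> c Z"
    and J: "J \<subseteq> {1..N} - {c}" and t0: "0 \<le> t0" and \<delta>: "0 < \<delta>"
    and drift: "\<tau> = ennreal t0 \<and> d = \<mu>\<^sup>2 / 2 \<or> \<tau> = \<infinity> \<and> d = - (\<mu>\<^sup>2 / 2)"
  shows "gaussian_walks M
    (\<lambda>k. report_filtration M N (reports W \<mu> \<tau> c Z) (t0 + real k * \<delta>)) J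
    (\<lambda>n k \<omega>. loglik \<mu> (\<lambda>t. signal W \<mu> \<tau> n t \<omega>) (t0 + real k * \<delta>)) (d * \<delta>) (\<bar>\<mu>\<bar> * sqrt \<delta>)"
proof -
  interpret prob_space M using noise by (simp add: sensor_noise_def)
  let ?F = "report_filtration M N (reports W \<mu> \<tau> c Z)"
  let ?l = "\<lambda>n k \<omega>. loglik \<mu> (\<lambda>t. signal W \<mu> \<tau> n t \<omega>) (t0 + real k * \<delta>)"
  let ?t = "\<lambda>k. t0 + real k * \<delta>"
  have tpos: "0 \<le> ?t k" for k using t0 \<delta> by simp
  have BM: "standard_brownian_motion M (W n)" if "n \<in> {1..N}" for n
    using noise that by (simp add: sensor_noise_def)
  have ZM: "Z t \<in> borel_measurable M" if "0 \<le> t" for t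
    using att that by (simp add: attack_def)
  have WM: "W n t \<in> borel_measurable M" if "n \<in> {1..N}" "0 \<le> t" for n t
    using BM[OF that(1)] that(2) by (simp add: standard_brownian_motion_def)
  have RM: "reports W \<mu> \<tau> c Z n t \<in> borel_measurable M" if "n \<in> {1..N}" "0 \<le> t" for n t
    unfolding reports_def signal_def using ZM[OF that(2)] WM[OF that] by simp
  have sub: "subalgebra M (?F t)" for t
    unfolding subalgebra_def report_filtration_def
    by (intro conjI sets_generated_by_subset) (auto simp: RM)
  have RF: "reports W \<mu> \<tau> c Z n s \<in> borel_measurable (?F t)"
    if "n \<in> {1..N}" "0 \<le> s" "s \<le> t" for n s t
    using generated_by_measurable[of "(n, s)" "{1..N} \<times> {0..t}" "\<lambda>(n, s). reports W \<mu> \<tau> c Z n s" M] that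
    unfolding report_filtration_def by simp
  have incr: "?l n (Suc k) \<omega> - ?l n k \<omega> = d * \<delta> + \<mu> * (W n (?t (Suc k)) \<omega> - W n (?t k) \<omega>)" for n k \<omega>
    using drift
  proof
    assume *: "\<tau> = ennreal t0 \<and> d = \<mu>\<^sup>2 / 2"
    have e: "enn2real (ennreal (?t j) - ennreal t0) = real j * \<delta>" for j
      using t0 \<delta> by (simp add: ennreal_minus)
    show ?thesis using * unfolding loglik_def signal_def
      by (simp only: e) (simp add: field_simps power2_eq_square)
  next
    assume "\<tau> = \<infinity> \<and> d = - (\<mu>\<^sup>2 / 2)"
    then have *: "\<tau> = \<infinity>" "d = - (\<mu>\<^sup>2 / 2)" by auto
    show ?thesis unfolding * loglik_def signal_no_change by (simp add: field_simps power2_eq_square)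
  qed
  show ?thesis
  proof
    show "finite J" using J by (rule finite_subset) simp
    show "0 < \<bar>\<mu>\<bar> * sqrt \<delta>" using \<mu> \<delta> by simp
    show "subalgebra M (?F (?t k))" for k by (rule sub)
    have "?t k \<le> ?t (Suc k)" for k using \<delta> by (simp add: field_simps)
    then have "reports W \<mu> \<tau> c Z n s \<in> borel_measurable (?F (?t (Suc k)))"
      if "n \<in> {1..N}" "0 \<le> s" "s \<le> ?t k" for n s k
      using RF[OF that(1,2)] that(3) order_trans by blast
    then have "sets (?F (?t k)) \<subseteq> sets (?F (?t (Suc k)))" for k
      unfolding report_filtration_def[of _ _ _ "?t k"]
      by (intro sets_generated_by_subset) auto
    then show "subalgebra (?F (?t (Suc k))) (?F (?t k))" for k
      unfolding subalgebra_def by simp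
  next
    fix n k assume "n \<in> J"
    then have n: "n \<in> {1..N}" "n \<noteq> c" using J by auto
    have "signal W \<mu> \<tau> n (?t k) \<in> borel_measurable (?F (?t k))"
      using RF[OF n(1) tpos order_refl, of k] n(2) unfolding reports_def[abs_def] by simp
    then show "?l n k \<in> borel_measurable (?F (?t k))" by (simp add: loglik_def)
    have lt: "?t k < ?t (Suc k)" using \<delta> by (simp add: field_simps)
    have "distributed M lborel (\<lambda>\<omega>. W n (?t (Suc k)) \<omega> - W n (?t k) \<omega>)
        (\<lambda>x. ennreal (normal_density 0 (sqrt (?t (Suc k) - ?t k)) x))"
      using BM[OF n(1)] tpos[of k] lt unfolding standard_brownian_motion_def by blast
    moreover have "?t (Suc k) - ?t k = \<delta>" by (simp add: algebra_simps)
    ultimately have D: "distributed M lborel (\<lambda>\<omega>. W n (?t (Suc k)) \<omega> - W n (?t k) \<omega>)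
        (\<lambda>x. ennreal (normal_density 0 (sqrt \<delta>) x))" by simp
    show "distributed M lborel (\<lambda>\<omega>. ?l n (Suc k) \<omega> - ?l n k \<omega>)
        (\<lambda>x. ennreal (normal_density (d * \<delta>) (\<bar>\<mu>\<bar> * sqrt \<delta>) x))"
      using normal_density_affine[OF D _ \<mu>, of "d * \<delta>"] \<delta> unfolding incr by simp
    let ?H = "honest_future M N W c (?t k)"
    have ind: "indep_set (sets (?F (?t k))) (sets ?H)"
      using att tpos[of k] by (simp add: attack_def)
    have "(\<lambda>\<omega>. W n (?t (Suc k)) \<omega> - W n (?t k) \<omega>) \<in> borel_measurable ?H"
      using generated_by_measurable[of "(n, ?t (Suc k))" "({1..N} - {c}) \<times> {?t k..}"
          "\<lambda>(n, u) \<omega>. W n u \<omega> - W n (?t k) \<omega>" M] n lt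
      unfolding honest_future_def by simp
    then have "(\<lambda>\<omega>. ?l n (Suc k) \<omega> - ?l n k \<omega>) \<in> borel_measurable ?H"
      unfolding incr by simp
    then have le: "sets (vimage_algebra (space M) (\<lambda>\<omega>. ?l n (Suc k) \<omega> - ?l n k \<omega>) borel) \<subseteq> sets ?H"
      by (intro sets_image_in_sets) (simp_all add: honest_future_def)
    show "indep_set (sets (?F (?t k)))
        (sets (vimage_algebra (space M) (\<lambda>\<omega>. ?l n (Suc k) \<omega> - ?l n k \<omega>) borel))"
      using ind unfolding indep_set_def
      by (rule indep_sets_mono_sets) (use le in \<open>auto split: bool.split\<close>)
  qed
qed

text \<open>The infimum over all past times is below the minimum over the grid points after \<open>t0\<close>. So the true
  statistic dominates the grid statistic started afresh at \<open>t0\<close>, whatever happened before \<open>t0\<close>.\<close>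
lemma alarm_le_grid_time:
  assumes "0 \<le> t0" "0 < \<delta>" and h: "h \<le> grid_cusum (\<lambda>k. loglik \<mu> x (t0 + real k * \<delta>)) k"
  shows "alarm \<mu> h x \<le> ennreal (t0 + real k * \<delta>)"
proof -
  let ?t = "\<lambda>k. t0 + real k * \<delta>"
  obtain j where j: "j \<le> k" "h \<le> loglik \<mu> x (?t k) - loglik \<mu> x (?t j)"
    using grid_cusum_attained[where l = "\<lambda>k. loglik \<mu> x (?t k)" and k = k] h by auto
  have "(INF s\<in>{0..?t k}. ereal (\<mu> * x s - \<mu>\<^sup>2 * s / 2)) \<le> ereal (loglik \<mu> x (?t j))"
    unfolding loglik_def using assms(1,2) j(1) by (intro INF_lower) (auto intro!: mult_right_mono)
  then have "ereal (loglik \<mu> x (?t k)) - ereal (loglik \<mu> x (?t j)) \<le> cusum \<mu> x (?t k)"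
    unfolding cusum_def by (intro ereal_minus_mono) (auto simp: loglik_def)
  moreover have "ereal h \<le> ereal (loglik \<mu> x (?t k)) - ereal (loglik \<mu> x (?t j))"
    using j(2) by simp
  ultimately have "ereal h \<le> cusum \<mu> x (?t k)" by (rule order_trans[rotated])
  then show ?thesis unfolding alarm_def using assms(1,2)
    by (intro Inf_lower CollectI exI[of _ "?t k"] conjI refl) simp_all
qed

lemma floor_grid_tendsto:
  fixes t :: real
  assumes "0 \<le> t"
  shows "(\<lambda>m. real (nat \<lfloor>t * real (Suc m)\<rfloor>) * (1 / real (Suc m))) \<longlonglongrightarrow> t"
proof (rule real_tendsto_sandwich)
  show "(\<lambda>m. t - 1 / real (Suc m)) \<longlonglongrightarrow> t"
    using tendsto_diff[OF tendsto_const LIMSEQ_inverse_real_of_nat, of t] by (simp add: inverse_eq_divide)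
  show "(\<lambda>m. t) \<longlonglongrightarrow> t" by simp
  have fl: "real (nat \<lfloor>t * real (Suc m)\<rfloor>) \<le> t * real (Suc m)"
    "t * real (Suc m) - 1 \<le> real (nat \<lfloor>t * real (Suc m)\<rfloor>)" for m
    using assms by (simp_all add: of_nat_floor)
  have "t - 1 / real (Suc m) = (t * real (Suc m) - 1) * (1 / real (Suc m))"
    "t = t * real (Suc m) * (1 / real (Suc m))" for m
    by (simp_all add: field_simps)
  then have "t - 1 / real (Suc m) \<le> real (nat \<lfloor>t * real (Suc m)\<rfloor>) * (1 / real (Suc m))"
    "real (nat \<lfloor>t * real (Suc m)\<rfloor>) * (1 / real (Suc m)) \<le> t" for m
    using mult_right_mono[OF fl(1)[of m], of "1 / real (Suc m)"]
      mult_right_mono[OF fl(2)[of m], of "1 / real (Suc m)"]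
    by (metis divide_nonneg_nonneg of_nat_0_le_iff zero_le_one)+
  then show
    "\<forall>\<^sub>F m in sequentially. t - 1 / real (Suc m) \<le> real (nat \<lfloor>t * real (Suc m)\<rfloor>) * (1 / real (Suc m))"
    "\<forall>\<^sub>F m in sequentially. real (nat \<lfloor>t * real (Suc m)\<rfloor>) * (1 / real (Suc m)) \<le> t"
    by (auto intro!: always_eventually)
qed

text \<open>Conversely, on a continuous path a sufficiently fine grid does not miss an alarm if the threshold
  is lowered slightly: the two times whose log-likelihoods differ by more than \<open>h'\<close> are limits of
  grid points from the left.\<close>
lemma eventually_grid_cusum_ge:
  assumes x: "continuous_on {0..} x" and u: "alarm \<mu> h x < ennreal u" and h': "h' < h"
  shows "\<forall>\<^sub>F m in sequentially. \<exists>k. real k \<le> u * real (Suc m) \<and>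
    h' \<le> grid_cusum (\<lambda>k. loglik \<mu> x (0 + real k * (1 / real (Suc m)))) k"
proof -
  obtain t where t: "0 \<le> t" "ereal h \<le> cusum \<mu> x t" "ennreal t < ennreal u"
    using u unfolding alarm_def Inf_less_iff by blast
  have tu: "t < u" using t by (simp add: ennreal_less_iff)
  have "\<exists>s\<in>{0..t}. h' < loglik \<mu> x t - loglik \<mu> x s"
  proof (rule ccontr)
    assume "\<not> ?thesis"
    then have "ereal (loglik \<mu> x t - h') \<le> (INF s\<in>{0..t}. ereal (\<mu> * x s - \<mu>\<^sup>2 * s / 2))"
      by (intro INF_greatest) (force simp: loglik_def not_less)
    then have "cusum \<mu> x t \<le> ereal (loglik \<mu> x t) - ereal (loglik \<mu> x t - h')"
      unfolding cusum_def by (intro ereal_minus_mono) (auto simp: loglik_def)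
    then have "cusum \<mu> x t \<le> ereal h'" by simp
    then have "ereal h \<le> ereal h'" using t(2) by (rule order_trans[rotated])
    with h' show False by simp
  qed
  then obtain s where s: "0 \<le> s" "s \<le> t" "h' < loglik \<mu> x t - loglik \<mu> x s" by auto
  have cont: "continuous_on {0..} (loglik \<mu> x)"
    unfolding loglik_def by (intro continuous_intros x) auto
  have lim: "(\<lambda>m. loglik \<mu> x (0 + real (nat \<lfloor>r * real (Suc m)\<rfloor>) * (1 / real (Suc m)))) \<longlonglongrightarrow> loglik \<mu> x r"
    if "0 \<le> r" for r
    using that floor_grid_tendsto[OF that]
    by (intro continuous_on_tendsto_compose[OF cont]) auto
  have "\<forall>\<^sub>F m in sequentially. h' <
      loglik \<mu> x (0 + real (nat \<lfloor>t * real (Suc m)\<rfloor>) * (1 / real (Suc m)))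
    - loglik \<mu> x (0 + real (nat \<lfloor>s * real (Suc m)\<rfloor>) * (1 / real (Suc m)))"
    using order_tendstoD(1)[OF tendsto_diff[OF lim[OF t(1)] lim[OF s(1)]] s(3)] .
  then show ?thesis
  proof eventually_elim
    case (elim m)
    have "nat \<lfloor>s * real (Suc m)\<rfloor> \<le> nat \<lfloor>t * real (Suc m)\<rfloor>"
      using s(2) by (intro nat_mono floor_mono mult_right_mono) auto
    from grid_cusum_ge[OF this, where l = "\<lambda>k. loglik \<mu> x (0 + real k * (1 / real (Suc m)))"]
    have "h' \<le> grid_cusum (\<lambda>k. loglik \<mu> x (0 + real k * (1 / real (Suc m)))) (nat \<lfloor>t * real (Suc m)\<rfloor>)"
      using elim by linarith
    moreover have "real (nat \<lfloor>t * real (Suc m)\<rfloor>) \<le> t * real (Suc m)" using t(1) by (simp add: of_nat_floor)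
    moreover have "t * real (Suc m) \<le> u * real (Suc m)" using tu by (intro mult_right_mono) auto
    ultimately show ?case by (intro exI[of _ "nat \<lfloor>t * real (Suc m)\<rfloor>"]) linarith
  qed
qed

section \<open>The detection delay\<close>

text \<open>The dominating random variable \<open>g\<close> is the alarm time of the grid CUSUM started at \<open>t0\<close>. The mesh
  \<open>1 / \<theta>\<^sup>2\<close> makes \<open>\<theta>\<close> times the standard deviation of an increment independent of \<open>\<theta>\<close>. The
  exponential moments of order \<open>\<theta>\<close> then stay bounded, and \<open>exp (- \<theta> * b)\<close> makes the loss per step
  negligible against the drift per step, which is of order \<open>1 / \<theta>\<^sup>2\<close>: \<open>q\<close> tends to \<open>\<mu>\<^sup>2 / 2\<close>.\<close>
lemma honest_alarm_delay:
  assumes \<mu>: "\<mu> \<noteq> 0" and noise: "sensor_noise M N W" and t0: "0 \<le> t0"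
    and att: "attack M N W \<mu> (ennreal t0) c Z"
    and n: "n \<in> {1..N} - {c}" and h: "0 < h" and b: "0 < b" and \<theta>: "1 \<le> \<theta>"
    and A: "A \<in> sets (report_filtration M N (reports W \<mu> (ennreal t0) c Z) t0)"
    and q: "0 < q" "q = \<mu>\<^sup>2 / 2 - \<theta>\<^sup>2 * (exp (b - \<theta> * b) *
      (exp (\<mu>\<^sup>2 / 2 / \<theta> + \<mu>\<^sup>2 / 2) + exp (- (\<mu>\<^sup>2 / 2 / \<theta>) + \<mu>\<^sup>2 / 2)))"
  obtains g where "g \<in> borel_measurable M"
    "\<And>\<omega>. \<omega> \<in> A \<Longrightarrow> alarm \<mu> h (\<lambda>t. signal W \<mu> (ennreal t0) n t \<omega>) - ennreal t0 \<le> g \<omega>"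
    "(\<integral>\<^sup>+ \<omega>. g \<omega> \<partial>M) \<le> ennreal (measure M A * (h + b + exp (- (h + 2 * b)) - exp (- b)) / q)"
proof -
  define \<delta> where "\<delta> = 1 / \<theta>\<^sup>2"
  have \<delta>: "0 < \<delta>" using \<theta> by (simp add: \<delta>_def)
  let ?l = "\<lambda>n k \<omega>. loglik \<mu> (\<lambda>t. signal W \<mu> (ennreal t0) n t \<omega>) (t0 + real k * \<delta>)"
  let ?m = "\<mu>\<^sup>2 / 2 * \<delta>"
  interpret G: gaussian_walks M
    "\<lambda>k. report_filtration M N (reports W \<mu> (ennreal t0) c Z) (t0 + real k * \<delta>)"
    "{n}" ?l ?m "\<bar>\<mu>\<bar> * sqrt \<delta>"
    using gaussian_walks_honest[OF \<mu> noise att _ t0 \<delta>, of "{n}" "\<mu>\<^sup>2 / 2"] n by simp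
  have A0: "A \<in> sets (report_filtration M N (reports W \<mu> (ennreal t0) c Z) (t0 + real 0 * \<delta>))"
    using A by simp
  have s: "(\<bar>\<mu>\<bar> * sqrt \<delta>)\<^sup>2 = 2 * ?m" using \<delta> by (simp add: power_mult_distrib)
  let ?\<eta> = "exp (b - \<theta> * b) * (exp (\<theta> * ?m + \<theta>\<^sup>2 * ?m) + exp (- \<theta> * ?m + \<theta>\<^sup>2 * ?m))"
  have e: "\<theta> * ?m = \<mu>\<^sup>2 / 2 / \<theta>" "- \<theta> * ?m = - (\<mu>\<^sup>2 / 2 / \<theta>)" "\<theta>\<^sup>2 * ?m = \<mu>\<^sup>2 / 2"
    using \<theta> by (simp_all add: \<delta>_def field_simps power2_eq_square)
  have q\<delta>: "q * \<delta> = ?m - ?\<eta>"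
    unfolding q(2) e using \<theta> by (simp add: \<delta>_def field_simps)
  then have \<eta>: "?\<eta> < ?m" using q(1) \<delta> by (smt (verit) mult_pos_pos)
  note [measurable] = G.quiet_measurable[OF A0, of h]
  define g where "g = (\<lambda>\<omega>. ennreal \<delta> * (\<Sum>k. indicator (G.quiet A h k) \<omega>))"
  have g: "g \<in> borel_measurable M" unfolding g_def by measurable
  have "(\<integral>\<^sup>+ \<omega>. g \<omega> \<partial>M) = ennreal \<delta> * (\<integral>\<^sup>+ \<omega>. (\<Sum>k. indicator (G.quiet A h k) \<omega>) \<partial>M)"
    unfolding g_def by (rule nn_integral_cmult) measurable
  also have "\<dots> \<le> ennreal \<delta> * ennreal (measure M A * (h + b + exp (- (h + 2 * b)) - exp (- b)) / (?m - ?\<eta>))"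
    by (intro mult_left_mono G.nn_quiet_time_le[OF _ s h b \<theta> A0 \<eta>, of n]) simp_all
  also have "\<dots> = ennreal (measure M A * (h + b + exp (- (h + 2 * b)) - exp (- b)) / q)"
  proof -
    have "exp (- b) \<le> b + exp (- (h + 2 * b)) + h"
      using mono_add_exp_minus[of b "h + 2 * b"] h b by simp
    then show ?thesis
      unfolding q\<delta>[symmetric] using \<delta> q(1) by (subst ennreal_mult[symmetric]) auto
  qed
  finally have gi: "(\<integral>\<^sup>+ \<omega>. g \<omega> \<partial>M) \<le> ennreal (measure M A * (h + b + exp (- (h + 2 * b)) - exp (- b)) / q)" .
  have ga: "alarm \<mu> h (\<lambda>t. signal W \<mu> (ennreal t0) n t \<omega>) - ennreal t0 \<le> g \<omega>" if \<omega>: "\<omega> \<in> A" for \<omega>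
  proof (cases "\<forall>k. \<omega> \<in> G.quiet A h k")
    case True
    then have "(\<Sum>k. indicator (G.quiet A h k) \<omega> :: ennreal) = (\<Sum>k. 1)" by simp
    also have "\<dots> = \<infinity>"
    proof -
      have "of_nat r \<le> (\<Sum>k. 1 :: ennreal)" for r
        using sum_le_suminf[of "\<lambda>k. 1 :: ennreal" "{..<r}"] by simp
      then show ?thesis
        by (metis ennreal_Ex_less_of_nat infinity_ennreal_def less_top not_le)
    qed
    finally have "g \<omega> = \<infinity>" using \<delta> unfolding g_def by (simp add: ennreal_mult_top)
    then show ?thesis by simp
  next
    case False
    define r where "r = (LEAST k. \<omega> \<notin> G.quiet A h k)"
    have r: "\<omega> \<notin> G.quiet A h r" "\<And>k. k < r \<Longrightarrow> \<omega> \<in> G.quiet A h k"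
      using False LeastI_ex[of "\<lambda>k. \<omega> \<notin> G.quiet A h k"] not_less_Least
      unfolding r_def by blast+
    obtain j where j: "j \<le> r" "h \<le> grid_cusum (\<lambda>k. ?l n k \<omega>) j"
      using r(1) \<omega> by (auto simp: G.quiet_def not_less)
    have "alarm \<mu> h (\<lambda>t. signal W \<mu> (ennreal t0) n t \<omega>) \<le> ennreal (t0 + real j * \<delta>)"
      by (rule alarm_le_grid_time[OF t0 \<delta> j(2)])
    also have "\<dots> \<le> ennreal (t0 + real r * \<delta>)"
      using j(1) \<delta> by (intro ennreal_leI add_left_mono mult_right_mono) auto
    finally have "alarm \<mu> h (\<lambda>t. signal W \<mu> (ennreal t0) n t \<omega>) - ennreal t0
        \<le> ennreal (t0 + real r * \<delta>) - ennreal t0" by (rule ennreal_minus_mono) simp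
    also have "\<dots> = ennreal \<delta> * (\<Sum>k<r. 1)"
      using t0 \<delta> by (simp add: ennreal_minus ennreal_mult ennreal_of_nat_eq_real_of_nat mult.commute del: ennreal_plus)
    also have "\<dots> = ennreal \<delta> * (\<Sum>k<r. indicator (G.quiet A h k) \<omega>)"
      using r(2) by simp
    also have "\<dots> \<le> g \<omega>"
      unfolding g_def by (intro mult_left_mono sum_le_suminf) auto
    finally show ?thesis .
  qed
  show thesis by (rule that[OF g ga gi])
qed

text \<open>The delay is at most the maximum, hence the sum, of the delays of two honest sensors, which
  explains \<open>4 / \<mu>\<^sup>2\<close> in place of the \<open>2 / \<mu>\<^sup>2\<close> of a single sensor. The mesh has to tend to 0 before \<open>b\<close>
  does.\<close>
lemma second_alarm_delay_on_event:
  assumes \<mu>: "\<mu> \<noteq> 0" and N: "N \<ge> 3" and noise: "sensor_noise M N W" and t0: "0 \<le> t0" and h: "0 < h"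
    and att: "(c, Z) \<in> attacks M N W \<mu> (ennreal t0) (second_alarm N \<mu> h)"
    and A: "A \<in> sets (report_filtration M N (reports W \<mu> (ennreal t0) c Z) t0)"
  defines "T \<equiv> stop_at (second_alarm N \<mu> h) (reports W \<mu> (ennreal t0) c Z)"
  shows "(\<integral>\<^sup>+ \<omega>\<in>A. (T \<omega> - ennreal t0) \<partial>M) \<le> ennreal (measure M A * (4 / \<mu>\<^sup>2 * (h - 1 + exp (- h))))"
proof -
  have c: "c \<in> {1..N}" and attack: "attack M N W \<mu> (ennreal t0) c Z"
    and T: "T \<in> borel_measurable M" using att by (auto simp: attacks_def T_def)
  obtain i j where ij: "i \<in> {1..N} - {c}" "j \<in> {1..N} - {c}" "i \<noteq> j"
  proof -
    have "card ({1..N} - {c}) = N - 1" using c by simp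
    then have "\<not> card ({1..N} - {c}) \<le> Suc 0" using N by simp
    then show thesis using that card_le_Suc0_iff_eq[of "{1..N} - {c}"]
      by (metis finite_Diff finite_atLeastAtMost)
  qed
  let ?a = "\<lambda>n \<omega>. alarm \<mu> h (\<lambda>t. signal W \<mu> (ennreal t0) n t \<omega>)"
  have T_le: "T \<omega> - ennreal t0 \<le> (?a i \<omega> - ennreal t0) + (?a j \<omega> - ennreal t0)" for \<omega>
  proof -
    have "T \<omega> \<le> max (?a i \<omega>) (?a j \<omega>)"
      using second_alarm_le_max[of i N j \<mu> h "\<lambda>n t. reports W \<mu> (ennreal t0) c Z n t \<omega>"] ij
      by (simp add: T_def stop_at_def reports_def)
    then have "T \<omega> - ennreal t0 \<le> max (?a i \<omega>) (?a j \<omega>) - ennreal t0"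
      by (rule ennreal_minus_mono) simp
    also have "\<dots> \<le> (?a i \<omega> - ennreal t0) + (?a j \<omega> - ennreal t0)"
      by (auto simp: max_def)
    finally show ?thesis .
  qed
  define C where "C = (\<lambda>b. h + b + exp (- (h + 2 * b)) - exp (- b))"
  define q where "q = (\<lambda>b \<theta>. \<mu>\<^sup>2 / 2 - \<theta>\<^sup>2 * (exp (b - \<theta> * b) *
      (exp (\<mu>\<^sup>2 / 2 / \<theta> + \<mu>\<^sup>2 / 2) + exp (- (\<mu>\<^sup>2 / 2 / \<theta>) + \<mu>\<^sup>2 / 2))))"
  have q_lim: "(\<lambda>m. q b (real (Suc m))) \<longlonglongrightarrow> \<mu>\<^sup>2 / 2" if "0 < b" for b
  proof -
    have "(q b \<longlongrightarrow> \<mu>\<^sup>2 / 2) at_top"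
      unfolding q_def using that by real_asymp
    then show ?thesis
      by (rule filterlim_compose)
         (rule filterlim_compose[OF filterlim_real_sequentially filterlim_Suc])
  qed
  have one: "(\<integral>\<^sup>+ \<omega>\<in>A. (T \<omega> - ennreal t0) \<partial>M) \<le> ennreal (2 * (measure M A * C b / q b \<theta>))"
    if b: "0 < b" and \<theta>: "1 \<le> \<theta>" and q: "0 < q b \<theta>" for b \<theta>
  proof -
    obtain f where f: "f \<in> borel_measurable M" "\<And>\<omega>. \<omega> \<in> A \<Longrightarrow> ?a i \<omega> - ennreal t0 \<le> f \<omega>"
      "(\<integral>\<^sup>+ \<omega>. f \<omega> \<partial>M) \<le> ennreal (measure M A * C b / q b \<theta>)"
      using honest_alarm_delay[OF \<mu> noise t0 attack ij(1) h b \<theta> A q q_def[THEN fun_cong, THEN fun_cong]]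
      unfolding C_def by blast
    obtain g where g: "g \<in> borel_measurable M" "\<And>\<omega>. \<omega> \<in> A \<Longrightarrow> ?a j \<omega> - ennreal t0 \<le> g \<omega>"
      "(\<integral>\<^sup>+ \<omega>. g \<omega> \<partial>M) \<le> ennreal (measure M A * C b / q b \<theta>)"
      using honest_alarm_delay[OF \<mu> noise t0 attack ij(2) h b \<theta> A q q_def[THEN fun_cong, THEN fun_cong]]
      unfolding C_def by blast
    have "(\<integral>\<^sup>+ \<omega>\<in>A. (T \<omega> - ennreal t0) \<partial>M) \<le> (\<integral>\<^sup>+ \<omega>. f \<omega> + g \<omega> \<partial>M)"
      using order_trans[OF T_le add_mono[OF f(2) g(2)]]
      by (intro nn_integral_mono) (simp add: indicator_def)
    also have "\<dots> = (\<integral>\<^sup>+ \<omega>. f \<omega> \<partial>M) + (\<integral>\<^sup>+ \<omega>. g \<omega> \<partial>M)"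
      using f(1) g(1) by (rule nn_integral_add)
    also have "\<dots> \<le> ennreal (measure M A * C b / q b \<theta>) + ennreal (measure M A * C b / q b \<theta>)"
      by (rule add_mono[OF f(3) g(3)])
    also have "\<dots> = ennreal (2 * (measure M A * C b / q b \<theta>))"
    proof -
      have "0 \<le> C b" using mono_add_exp_minus[of b "h + 2 * b"] h b by (simp add: C_def)
      then show ?thesis using q by (simp flip: ennreal_plus)
    qed
    finally show ?thesis .
  qed
  have two: "(\<integral>\<^sup>+ \<omega>\<in>A. (T \<omega> - ennreal t0) \<partial>M) \<le> ennreal (2 * (measure M A * C b / (\<mu>\<^sup>2 / 2)))"
    if b: "0 < b" for b
  proof (rule LIMSEQ_le_const)
    show "(\<lambda>m. ennreal (2 * (measure M A * C b / q b (real (Suc m)))))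
        \<longlonglongrightarrow> ennreal (2 * (measure M A * C b / (\<mu>\<^sup>2 / 2)))"
      using \<mu> by (intro tendsto_ennrealI tendsto_intros q_lim b) simp
    have "\<forall>\<^sub>F m in sequentially. 0 < q b (real (Suc m))"
      using order_tendstoD(1)[OF q_lim[OF b], of 0] \<mu> by simp
    then have "\<forall>\<^sub>F m in sequentially. (\<integral>\<^sup>+ \<omega>\<in>A. (T \<omega> - ennreal t0) \<partial>M)
        \<le> ennreal (2 * (measure M A * C b / q b (real (Suc m))))"
      by eventually_elim (rule one[OF b], auto)
    then show "\<exists>k. \<forall>m\<ge>k. (\<integral>\<^sup>+ \<omega>\<in>A. (T \<omega> - ennreal t0) \<partial>M)
        \<le> ennreal (2 * (measure M A * C b / q b (real (Suc m))))"
      by (simp add: eventually_sequentially)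
  qed
  have "(\<integral>\<^sup>+ \<omega>\<in>A. (T \<omega> - ennreal t0) \<partial>M) \<le> ennreal (2 * (measure M A * (h - 1 + exp (- h)) / (\<mu>\<^sup>2 / 2)))"
  proof (rule tendsto_lowerbound)
    have "(C \<longlongrightarrow> h + 0 + exp (- (h + 2 * 0)) - exp (- 0)) (at_right 0)"
      unfolding C_def by (intro tendsto_intros)
    then have C_lim: "(C \<longlongrightarrow> h - 1 + exp (- h)) (at_right 0)" by (simp add: algebra_simps)
    show "((\<lambda>b. ennreal (2 * (measure M A * C b / (\<mu>\<^sup>2 / 2))))
        \<longlongrightarrow> ennreal (2 * (measure M A * (h - 1 + exp (- h)) / (\<mu>\<^sup>2 / 2)))) (at_right 0)"
      using \<mu> by (intro tendsto_ennrealI tendsto_intros C_lim) simp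
    show "\<forall>\<^sub>F b in at_right 0. (\<integral>\<^sup>+ \<omega>\<in>A. (T \<omega> - ennreal t0) \<partial>M) \<le> ennreal (2 * (measure M A * C b / (\<mu>\<^sup>2 / 2)))"
      using two by (auto simp: eventually_at_right_field intro: exI[of _ 1])
  qed simp
  then show ?thesis by (simp add: field_simps)
qed

lemma AE_nn_cond_exp_le:
  assumes "finite_measure M" and sub: "subalgebra M F" and f: "f \<in> borel_measurable M"
    and le: "\<And>A. A \<in> sets F \<Longrightarrow> (\<integral>\<^sup>+ \<omega>\<in>A. f \<omega> \<partial>M) \<le> ennreal (measure M A * C)" and C: "0 \<le> C"
  shows "AE \<omega> in M. nn_cond_exp M F f \<omega> \<le> ennreal C"
proof -
  interpret finite_measure M by fact
  interpret finite_measure_subalgebra M F by unfold_locales (rule sub)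
  note [measurable] = f
  \<comment> \<open>The slack \<open>1 / (j + 1)\<close> gives a strict excess over \<open>C\<close>, which the test event must not have.\<close>
  define B where "B j = {\<omega> \<in> space F. ennreal (C + 1 / real (Suc j)) \<le> nn_cond_exp M F f \<omega>}" for j
  have BF [measurable]: "B j \<in> sets F" for j unfolding B_def by measurable
  then have BM [measurable]: "B j \<in> sets M" for j using sub by (auto simp: subalgebra_def)
  have null: "measure M (B j) = 0" for j
  proof -
    have "ennreal ((C + 1 / real (Suc j)) * measure M (B j)) = (\<integral>\<^sup>+ \<omega>. ennreal (C + 1 / real (Suc j)) * indicator (B j) \<omega> \<partial>M)"
      using C by (simp add: nn_integral_cmult_indicator emeasure_eq_measure ennreal_mult)
    also have "\<dots> \<le> (\<integral>\<^sup>+ \<omega>. indicator (B j) \<omega> * nn_cond_exp M F f \<omega> \<partial>M)"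
      by (intro nn_integral_mono) (auto simp: B_def indicator_def)
    also have "\<dots> = (\<integral>\<^sup>+ \<omega>. indicator (B j) \<omega> * f \<omega> \<partial>M)"
      by (rule nn_cond_exp_intg) measurable
    also have "\<dots> \<le> ennreal (measure M (B j) * C)" using le[OF BF] by (simp add: mult.commute)
    finally have "(C + 1 / real (Suc j)) * measure M (B j) \<le> measure M (B j) * C"
      using C by (subst (asm) ennreal_le_iff) auto
    then have "1 / real (Suc j) * measure M (B j) \<le> 0" by (simp add: algebra_simps)
    then show ?thesis by (simp add: divide_le_0_iff measure_le_0_iff)
  qed
  have "AE \<omega> in M. \<forall>j. \<omega> \<notin> B j"
    unfolding AE_all_countable using null BM
    by (auto intro!: AE_not_in null_setsI simp: emeasure_eq_measure)
  then show ?thesis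
  proof (rule AE_mp, intro AE_I2 impI)
    fix \<omega> assume \<omega>: "\<omega> \<in> space M" "\<forall>j. \<omega> \<notin> B j"
    have "space F = space M" using sub by (simp add: subalgebra_def)
    then have *: "nn_cond_exp M F f \<omega> \<le> ennreal (C + 1 / real (Suc j))" for j
      using \<omega> by (auto simp: B_def not_le less_imp_le)
    have "(\<lambda>j. ennreal (C + 1 / real (Suc j))) \<longlonglongrightarrow> ennreal (C + 0)"
      using LIMSEQ_inverse_real_of_nat by (intro tendsto_ennrealI tendsto_intros) (simp add: inverse_eq_divide)
    from LIMSEQ_le_const[OF this] * show "nn_cond_exp M F f \<omega> \<le> ennreal C" by auto
  qed
qed

theorem delay_second_alarm_le:
  assumes \<mu>: "\<mu> \<noteq> 0" and N: "N \<ge> 3" and noise: "sensor_noise M N W" and h: "0 < h"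
  shows "delay M N W \<mu> (second_alarm N \<mu> h) \<le> ennreal (4 / \<mu>\<^sup>2 * (h - 1 + exp (- h)))"
  unfolding delay_def
proof (intro SUP_least)
  fix t0 :: real and p
  assume t0: "t0 \<in> {0..}" and p: "p \<in> attacks M N W \<mu> (ennreal t0) (second_alarm N \<mu> h)"
  obtain c Z where cZ_eq: "p = (c, Z)" by (cases p)
  note cZ = p[unfolded cZ_eq]
  let ?R = "reports W \<mu> (ennreal t0) c Z"
  have t0': "0 \<le> t0" using t0 by simp
  interpret prob_space M using noise by (simp add: sensor_noise_def)
  have att: "attack M N W \<mu> (ennreal t0) c Z"
    and T: "stop_at (second_alarm N \<mu> h) ?R \<in> borel_measurable M"
    using cZ by (auto simp: attacks_def)
  \<comment> \<open>An empty family of sensors, only to know that the reports generate a subalgebra.\<close>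
  interpret G: gaussian_walks M "\<lambda>k. report_filtration M N ?R (t0 + real k * 1)" "{}"
    "\<lambda>n k \<omega>. loglik \<mu> (\<lambda>t. signal W \<mu> (ennreal t0) n t \<omega>) (t0 + real k * 1)"
    "\<mu>\<^sup>2 / 2 * 1" "\<bar>\<mu>\<bar> * sqrt 1"
    by (rule gaussian_walks_honest[OF \<mu> noise att]) (use t0 in auto)
  have "subalgebra M (report_filtration M N ?R t0)" using G.subalgebra[of 0] by simp
  moreover have "0 \<le> 4 / \<mu>\<^sup>2 * (h - 1 + exp (- h))"
    using exp_ge_add_one_self[of "- h"] by (intro mult_nonneg_nonneg) (simp, linarith)
  ultimately have "AE \<omega> in M. nn_cond_exp M (report_filtration M N ?R t0)
      (\<lambda>\<omega>. stop_at (second_alarm N \<mu> h) ?R \<omega> - ennreal t0) \<omega> \<le> ennreal (4 / \<mu>\<^sup>2 * (h - 1 + exp (- h)))"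
    using T by (intro AE_nn_cond_exp_le second_alarm_delay_on_event[OF \<mu> N noise t0' h cZ]
        finite_measure_axioms borel_measurable_minus_ennreal borel_measurable_const)
  then have "esssup M (nn_cond_exp M (report_filtration M N ?R t0)
      (\<lambda>\<omega>. stop_at (second_alarm N \<mu> h) ?R \<omega> - ennreal t0)) \<le> ennreal (4 / \<mu>\<^sup>2 * (h - 1 + exp (- h)))"
    by (intro esssup_I borel_measurable_nn_cond_exp2)
  then show "(case p of (c, Z) \<Rightarrow> esssup M (nn_cond_exp M
      (report_filtration M N (reports W \<mu> (ennreal t0) c Z) t0)
      (\<lambda>\<omega>. stop_at (second_alarm N \<mu> h) (reports W \<mu> (ennreal t0) c Z) \<omega> - ennreal t0)))
      \<le> ennreal (4 / \<mu>\<^sup>2 * (h - 1 + exp (- h)))"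
    unfolding cZ_eq prod.case .
qed

section \<open>The average run length\<close>

text \<open>The grid is refined up to the fixed time horizon \<open>t\<close>. The random variables whose means are compared
  in \<open>quiet_time_ge\<close> are called \<open>u\<close> and \<open>v\<close> in the proof. If the detection time \<open>T\<close> is before \<open>t\<close>, then an
  honest sensor has alarmed by \<open>T\<close>, hence so has a fine grid at the threshold \<open>h' < h\<close> by any time
  after \<open>T\<close>. So Fatou's lemma applies to \<open>u\<close>, and the reverse Fatou lemma to \<open>v\<close>, which is at most a
  multiple of \<open>t\<close>.\<close>
lemma run_length_on_event:
  assumes \<mu>: "\<mu> \<noteq> 0" and N: "N \<ge> 3" and noise: "sensor_noise M N W"
    and h': "0 < h'" "h' < h"
    and cZ: "(c, Z) \<in> attacks M N W \<mu> \<infinity> (second_alarm N \<mu> h)"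
  defines "T \<equiv> stop_at (second_alarm N \<mu> h) (reports W \<mu> \<infinity> c Z)"
  shows "ennreal (exp h' - h' - 1) * emeasure M {\<omega>\<in>space M. T \<omega> < of_nat t}
    \<le> ennreal ((real N - 1) * \<mu>\<^sup>2 / 2) * (\<integral>\<^sup>+ \<omega>. T \<omega> \<partial>M)"
proof -
  interpret prob_space M using noise by (simp add: sensor_noise_def)
  have c: "c \<in> {1..N}" and att: "attack M N W \<mu> \<infinity> c Z" and T [measurable]: "T \<in> borel_measurable M"
    using cZ by (auto simp: attacks_def T_def)
  let ?J = "{1..N} - {c}"
  define l where "l m n k \<omega> = loglik \<mu> (\<lambda>t. signal W \<mu> \<infinity> n t \<omega>) (0 + real k * (1 / real (Suc m)))"
    for m n k \<omega>
  let ?s = "\<lambda>m. \<bar>\<mu>\<bar> * sqrt (1 / real (Suc m))" and ?m = "\<lambda>m. - (\<mu>\<^sup>2 / 2) * (1 / real (Suc m))"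
  let ?F = "\<lambda>m k. report_filtration M N (reports W \<mu> \<infinity> c Z) (0 + real k * (1 / real (Suc m)))"
  have G: "gaussian_walks M (?F m) ?J (l m) (?m m) (?s m)" for m
    unfolding l_def[abs_def] by (rule gaussian_walks_honest[OF \<mu> noise att]) auto
  define Q where "Q m k = gaussian_walks.quiet ?J (l m) (space M) h' k" for m k
  define K where "K m = t * Suc m" for m
  define a where "a = exp h' - h' - 1"
  define C where "C = (real N - 1) * \<mu>\<^sup>2 / 2"
  have a: "0 \<le> a" using exp_ge_add_one_self[of h'] unfolding a_def by linarith
  have C: "0 < C" using N \<mu> by (simp add: C_def)
  have Q_meas [measurable]: "Q m k \<in> sets M" for m k
    unfolding Q_def by (rule gaussian_walks.quiet_measurable[OF G])
      (metis gaussian_walks.space_F[OF G] sets.top)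
  have Q_iff: "\<omega> \<in> Q m k \<longleftrightarrow> \<omega> \<in> space M \<and> (\<forall>n\<in>?J. \<forall>j\<le>k. grid_cusum (\<lambda>j. l m n j \<omega>) j < h')" for m k \<omega>
    unfolding Q_def gaussian_walks.quiet_def[OF G] by simp
  define u where "u m \<omega> = ennreal (a * indicator (space M - Q m (K m)) \<omega>)" for m \<omega>
  define v where "v m \<omega> = ennreal (C * ((1 / real (Suc m)) * (\<Sum>k<K m. indicator (Q m k) \<omega>)))" for m \<omega>
  have u_meas [measurable]: "u m \<in> borel_measurable M" and v_meas [measurable]: "v m \<in> borel_measurable M" for m
    unfolding u_def[abs_def] v_def[abs_def] by measurable
  have int: "(\<integral>\<^sup>+ \<omega>. u m \<omega> \<partial>M) \<le> (\<integral>\<^sup>+ \<omega>. v m \<omega> \<partial>M)" for m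
  proof -
    have s: "(?s m)\<^sup>2 = - 2 * ?m m" by (simp add: power_mult_distrib field_simps)
    have card: "real (card ?J) = real N - 1" using c by (simp add: of_nat_diff)
    have "(\<integral>\<^sup>+ \<omega>. u m \<omega> \<partial>M) = ennreal a * emeasure M (space M - Q m (K m))"
      unfolding u_def using a
      by (simp add: ennreal_mult ennreal_indicator nn_integral_cmult_indicator)
    also have "\<dots> = ennreal (a * prob (space M - Q m (K m)))"
      using a by (simp add: emeasure_eq_measure ennreal_mult)
    also have "a * prob (space M - Q m (K m)) \<le> real (card ?J) * (- ?m m) * (\<Sum>k<K m. prob (Q m k))"
      unfolding a_def Q_def by (rule gaussian_walks.quiet_time_ge[OF G s h'(1)])
    also have "\<dots> = C * (1 / real (Suc m)) * (\<Sum>k<K m. prob (Q m k))"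
      unfolding card C_def by simp
    also have "ennreal \<dots> = ennreal (C * (1 / real (Suc m))) * (\<Sum>k<K m. emeasure M (Q m k))"
      using C by (subst ennreal_mult) (auto simp: sum_nonneg emeasure_eq_measure sum_ennreal)
    also have "\<dots> = ennreal (C * (1 / real (Suc m))) * (\<integral>\<^sup>+ \<omega>. (\<Sum>k<K m. indicator (Q m k) \<omega>) \<partial>M)"
      by (subst nn_integral_sum) auto
    also have "\<dots> = (\<integral>\<^sup>+ \<omega>. ennreal (C * (1 / real (Suc m))) * (\<Sum>k<K m. indicator (Q m k) \<omega>) \<partial>M)"
      by (rule nn_integral_cmult[symmetric]) measurable
    also have "\<dots> = (\<integral>\<^sup>+ \<omega>. v m \<omega> \<partial>M)"
    proof (rule nn_integral_cong)
      fix \<omega>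
      have "(\<Sum>k<K m. indicator (Q m k) \<omega> :: ennreal) = ennreal (\<Sum>k<K m. indicator (Q m k) \<omega>)"
        by (subst sum_ennreal[symmetric]) (auto simp: ennreal_indicator)
      then show "ennreal (C * (1 / real (Suc m))) * (\<Sum>k<K m. indicator (Q m k) \<omega>) = v m \<omega>"
        using C unfolding v_def mult.assoc[symmetric]
        by (subst ennreal_mult[of "C * (1 / real (Suc m))"]) (auto intro!: sum_nonneg)
    qed
    finally show ?thesis by (simp add: ennreal_leI)
  qed
  have early: "\<forall>\<^sub>F m in sequentially. \<exists>k. real k \<le> r * real (Suc m) \<and> (\<forall>j\<ge>k. \<omega> \<notin> Q m j)"
    if \<omega>: "\<omega> \<in> space M" and r: "T \<omega> < ennreal r" for \<omega> r
  proof -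
    obtain n where n: "n \<in> {1..N}" "n \<noteq> c"
      "alarm \<mu> h (\<lambda>t. reports W \<mu> \<infinity> c Z n t \<omega>) \<le> second_alarm N \<mu> h (\<lambda>n t. reports W \<mu> \<infinity> c Z n t \<omega>)"
      using alarm_le_second_alarm[of N c \<mu> h "\<lambda>n t. reports W \<mu> \<infinity> c Z n t \<omega>"] N by auto
    then have al: "alarm \<mu> h (\<lambda>t. signal W \<mu> \<infinity> n t \<omega>) < ennreal r"
      using r unfolding T_def stop_at_def by (simp add: reports_def)
    have "standard_brownian_motion M (W n)" using noise n(1) by (simp add: sensor_noise_def)
    then have cont: "continuous_on {0..} (\<lambda>t. signal W \<mu> \<infinity> n t \<omega>)"
      using \<omega> unfolding signal_no_change standard_brownian_motion_def by blast
    from eventually_grid_cusum_ge[OF cont al h'(2)] show ?thesis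
    proof eventually_elim
      case (elim m)
      then obtain k where k: "real k \<le> r * real (Suc m)" "h' \<le> grid_cusum (\<lambda>k. l m n k \<omega>) k"
        unfolding l_def by blast
      then have "\<omega> \<notin> Q m j" if "k \<le> j" for j
        using n that unfolding Q_iff by (auto simp: not_less)
      with k show ?case by blast
    qed
  qed
  have "ennreal a * emeasure M {\<omega>\<in>space M. T \<omega> < of_nat t}
      = (\<integral>\<^sup>+ \<omega>. ennreal a * indicator {\<omega>\<in>space M. T \<omega> < of_nat t} \<omega> \<partial>M)"
    by (rule nn_integral_cmult_indicator[symmetric]) measurable
  also have "\<dots> \<le> (\<integral>\<^sup>+ \<omega>. liminf (\<lambda>m. u m \<omega>) \<partial>M)"
  proof (rule nn_integral_mono)
    fix \<omega> assume \<omega>: "\<omega> \<in> space M"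
    show "ennreal a * indicator {\<omega>\<in>space M. T \<omega> < of_nat t} \<omega> \<le> liminf (\<lambda>m. u m \<omega>)"
    proof (cases "T \<omega> < of_nat t")
      case True
      then have "T \<omega> < ennreal (real t)" by (simp add: ennreal_of_nat_eq_real_of_nat)
      from early[OF \<omega> this] have "\<forall>\<^sub>F m in sequentially. ennreal a \<le> u m \<omega>"
      proof eventually_elim
        case (elim m)
        then obtain k where k: "real k \<le> real t * real (Suc m)" "\<forall>j\<ge>k. \<omega> \<notin> Q m j" by blast
        from k(1) have "k \<le> K m" unfolding K_def of_nat_mult[symmetric] of_nat_le_iff .
        with k \<omega> show ?case by (simp add: u_def)
      qed
      then have "ennreal a \<le> liminf (\<lambda>m. u m \<omega>)" by (rule Liminf_bounded)
      then show ?thesis using True \<omega> by simp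
    qed simp
  qed
  also have "\<dots> \<le> liminf (\<lambda>m. \<integral>\<^sup>+ \<omega>. u m \<omega> \<partial>M)"
    by (rule nn_integral_liminf) measurable
  also have "\<dots> \<le> liminf (\<lambda>m. \<integral>\<^sup>+ \<omega>. v m \<omega> \<partial>M)"
    by (intro Liminf_mono always_eventually allI int)
  also have "\<dots> \<le> limsup (\<lambda>m. \<integral>\<^sup>+ \<omega>. v m \<omega> \<partial>M)"
    by (rule Liminf_le_Limsup) simp
  also have "\<dots> \<le> (\<integral>\<^sup>+ \<omega>. limsup (\<lambda>m. v m \<omega>) \<partial>M)"
  proof (rule nn_integral_limsup[where w = "\<lambda>_. ennreal (C * real t)"])
    have "v m \<omega> \<le> ennreal (C * real t)" for m \<omega>
    proof -
      have "(\<Sum>k<K m. indicator (Q m k) \<omega> :: real) \<le> (\<Sum>k<K m. 1)"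
        by (intro sum_mono) (simp add: indicator_def)
      then have "1 / real (Suc m) * (\<Sum>k<K m. indicator (Q m k) \<omega>) \<le> 1 / real (Suc m) * real (K m)"
        by (intro mult_left_mono) auto
      also have "\<dots> = real t" by (simp add: K_def field_simps)
      finally show ?thesis unfolding v_def using C by (intro ennreal_leI mult_left_mono) auto
    qed
    then show "AE \<omega> in M. v m \<omega> \<le> ennreal (C * real t)" for m by simp
    show "(\<integral>\<^sup>+ \<omega>. ennreal (C * real t) \<partial>M) < \<infinity>" by (simp add: emeasure_space_1)
  qed measurable
  also have "\<dots> \<le> (\<integral>\<^sup>+ \<omega>. ennreal C * T \<omega> \<partial>M)"
  proof (rule nn_integral_mono)
    fix \<omega> assume \<omega>: "\<omega> \<in> space M"
    have upper: "limsup (\<lambda>m. v m \<omega>) \<le> ennreal (C * r)" if r: "T \<omega> < ennreal r" for r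
    proof (rule Limsup_bounded)
      from early[OF \<omega> r] show "\<forall>\<^sub>F m in sequentially. v m \<omega> \<le> ennreal (C * r)"
      proof eventually_elim
        case (elim m)
        then obtain k where k: "real k \<le> r * real (Suc m)" "\<forall>j\<ge>k. \<omega> \<notin> Q m j" by blast
        have "(\<Sum>i<K m. indicator (Q m i) \<omega> :: real) \<le> (\<Sum>i<K m. of_bool (i < k))"
          using k(2) not_le by (intro sum_mono) (auto simp: indicator_def)
        also have "\<dots> = real (card ({..<K m} \<inter> {i. i < k}))" by simp
        also have "\<dots> \<le> real (card {..<k})" by (intro of_nat_mono card_mono) auto
        also have "\<dots> \<le> r * real (Suc m)" using k(1) by simp
        finally have "1 / real (Suc m) * (\<Sum>i<K m. indicator (Q m i) \<omega>) \<le> 1 / real (Suc m) * (r * real (Suc m))"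
          by (intro mult_left_mono) auto
        also have "\<dots> = r" by (simp del: of_nat_Suc)
        finally show ?case unfolding v_def using C by (intro ennreal_leI mult_left_mono) auto
      qed
    qed
    show "limsup (\<lambda>m. v m \<omega>) \<le> ennreal C * T \<omega>"
    proof (cases "T \<omega>")
      case (real r)
      have "(\<lambda>i. ennreal (C * (r + 1 / real (Suc i)))) \<longlonglongrightarrow> ennreal (C * (r + 0))"
        using LIMSEQ_inverse_real_of_nat by (intro tendsto_ennrealI tendsto_intros) (simp add: inverse_eq_divide)
      moreover have "limsup (\<lambda>m. v m \<omega>) \<le> ennreal (C * (r + 1 / real (Suc i)))" for i
        using real by (intro upper) (simp add: ennreal_less_iff)
      ultimately have "limsup (\<lambda>m. v m \<omega>) \<le> ennreal (C * (r + 0))"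
        by (intro LIMSEQ_le_const) auto
      then show ?thesis using real C by (simp add: ennreal_mult)
    next
      case top
      then show ?thesis using C by (simp add: ennreal_mult_top)
    qed
  qed
  also have "\<dots> = ennreal C * (\<integral>\<^sup>+ \<omega>. T \<omega> \<partial>M)" by (rule nn_integral_cmult) measurable
  finally show ?thesis unfolding a_def C_def .
qed

text \<open>If the detection time has finite mean, it is finite almost surely. The horizon then tends to
  infinity, and the threshold \<open>h'\<close> to \<open>h\<close>.\<close>
theorem ARL_second_alarm_ge:
  assumes \<mu>: "\<mu> \<noteq> 0" and N: "N \<ge> 3" and noise: "sensor_noise M N W" and h: "0 < h"
  shows "ennreal (2 / ((real N - 1) * \<mu>\<^sup>2) * (exp h - h - 1)) \<le> ARL M N W \<mu> (second_alarm N \<mu> h)"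
  unfolding ARL_def
proof (rule INF_greatest)
  fix p assume p: "p \<in> attacks M N W \<mu> \<infinity> (second_alarm N \<mu> h)"
  obtain c Z where cZ_eq: "p = (c, Z)" by (cases p)
  note cZ = p[unfolded cZ_eq]
  interpret prob_space M using noise by (simp add: sensor_noise_def)
  define T where "T = stop_at (second_alarm N \<mu> h) (reports W \<mu> \<infinity> c Z)"
  let ?C = "(real N - 1) * \<mu>\<^sup>2 / 2"
  have T [measurable]: "T \<in> borel_measurable M" using cZ by (simp add: attacks_def T_def)
  have C: "0 < ?C" using N \<mu> by simp
  have "ennreal (2 / ((real N - 1) * \<mu>\<^sup>2) * (exp h - h - 1)) \<le> (\<integral>\<^sup>+ \<omega>. T \<omega> \<partial>M)"
  proof (cases "(\<integral>\<^sup>+ \<omega>. T \<omega> \<partial>M) = \<infinity>")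
    case False
    have AE: "AE \<omega> in M. T \<omega> \<noteq> \<infinity>" by (rule nn_integral_noteq_infinite[OF T False])
    have "(SUP t. emeasure M {\<omega>\<in>space M. T \<omega> < of_nat t}) = emeasure M (\<Union>t. {\<omega>\<in>space M. T \<omega> < of_nat t})"
    proof (rule SUP_emeasure_incseq)
      show "range (\<lambda>t. {\<omega>\<in>space M. T \<omega> < of_nat t}) \<subseteq> sets M" by auto
      show "incseq (\<lambda>t. {\<omega>\<in>space M. T \<omega> < of_nat t})"
        by (auto simp: incseq_def elim!: less_le_trans intro!: of_nat_mono)
    qed
    also have "\<dots> = emeasure M (space M)"
    proof (rule emeasure_eq_AE)
      show "AE \<omega> in M. \<omega> \<in> (\<Union>t. {\<omega>\<in>space M. T \<omega> < of_nat t}) \<longleftrightarrow> \<omega> \<in> space M"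
        using AE by eventually_elim (simp add: less_top ennreal_Ex_less_of_nat)
    qed auto
    finally have sup: "(SUP t. emeasure M {\<omega>\<in>space M. T \<omega> < of_nat t}) = 1"
      by (simp add: emeasure_space_1)
    have below: "ennreal (exp h' - h' - 1) \<le> ennreal ?C * (\<integral>\<^sup>+ \<omega>. T \<omega> \<partial>M)" if h': "0 < h'" "h' < h" for h'
    proof -
      have "ennreal (exp h' - h' - 1) = (SUP t. ennreal (exp h' - h' - 1) * emeasure M {\<omega>\<in>space M. T \<omega> < of_nat t})"
        by (simp add: SUP_mult_left_ennreal[symmetric] sup)
      also have "\<dots> \<le> ennreal ?C * (\<integral>\<^sup>+ \<omega>. T \<omega> \<partial>M)"
        by (intro SUP_least run_length_on_event[OF \<mu> N noise h' cZ, folded T_def])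
      finally show ?thesis .
    qed
    have "ennreal (exp h - h - 1) \<le> ennreal ?C * (\<integral>\<^sup>+ \<omega>. T \<omega> \<partial>M)"
    proof (rule tendsto_upperbound)
      show "((\<lambda>h'. ennreal (exp h' - h' - 1)) \<longlongrightarrow> ennreal (exp h - h - 1)) (at_left h)"
        by (intro tendsto_ennrealI tendsto_intros)
      show "\<forall>\<^sub>F h' in at_left h. ennreal (exp h' - h' - 1) \<le> ennreal ?C * (\<integral>\<^sup>+ \<omega>. T \<omega> \<partial>M)"
        using below h by (auto simp: eventually_at_left_field intro!: exI[of _ 0])
    qed simp
    then have "ennreal (1 / ?C) * ennreal (exp h - h - 1) \<le> ennreal (1 / ?C) * (ennreal ?C * (\<integral>\<^sup>+ \<omega>. T \<omega> \<partial>M))"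
      by (rule mult_left_mono) simp
    also have "\<dots> = (\<integral>\<^sup>+ \<omega>. T \<omega> \<partial>M)"
      unfolding mult.assoc[symmetric] using C by (subst ennreal_mult[symmetric]) auto
    also have "ennreal (1 / ?C) * ennreal (exp h - h - 1) = ennreal (2 / ((real N - 1) * \<mu>\<^sup>2) * (exp h - h - 1))"
    proof -
      have "0 \<le> exp h - h - 1" using exp_ge_add_one_self[of h] by linarith
      then show ?thesis using C by (subst ennreal_mult[symmetric]) auto
    qed
    finally show ?thesis .
  qed simp
  then show "ennreal (2 / ((real N - 1) * \<mu>\<^sup>2) * (exp h - h - 1))
      \<le> (case p of (c, Z) \<Rightarrow>
           \<integral>\<^sup>+ \<omega>. stop_at (second_alarm N \<mu> h) (reports W \<mu> \<infinity> c Z) \<omega> \<partial>M)"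
    unfolding cZ_eq prod.case T_def .
qed

section \<open>The trade-off\<close>

lemma ln_le_ln_ext:
  assumes "0 < x" "ennreal x \<le> a"
  shows "ereal (ln x) \<le> ln_ext a"
proof (cases a)
  case (real r)
  then show ?thesis using assms by (auto simp: ln_ext_def ennreal_le_iff)
next
  case top
  then show ?thesis by (simp add: ln_ext_def)
qed

theorem theorem3p2:
  fixes M :: "'a measure" and W :: "nat \<Rightarrow> real \<Rightarrow> 'a \<Rightarrow> real" and N :: nat and \<mu> :: real
  assumes "N \<ge> 3" and "\<mu> \<noteq> 0" and "sensor_noise M N W"
  shows "\<exists>\<epsilon> :: real \<Rightarrow> real. (\<epsilon> \<longlongrightarrow> 0) at_top \<and>
    (\<forall>\<^sub>F h in at_top.
       enn2ereal (delay M N W \<mu> (second_alarm N \<mu> h))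
         \<le> ereal (4 / \<mu>\<^sup>2) *
             (ln_ext (ARL M N W \<mu> (second_alarm N \<mu> h))
              + ereal (ln ((real N - 1) * \<mu>\<^sup>2 / 2) - 1 + \<epsilon> h)))"
proof (intro exI conjI)
  \<comment> \<open>The two bounds differ from \<open>h - 1\<close> and \<open>exp h\<close> by \<open>exp (- h)\<close> and by a factor
    \<open>1 - (h + 1) * exp (- h)\<close>; their effects add up.\<close>
  let ?\<epsilon> = "\<lambda>h :: real. exp (- h) - ln (1 - (h + 1) * exp (- h))"
  show "(?\<epsilon> \<longlongrightarrow> 0) at_top" by real_asymp
  show "\<forall>\<^sub>F h in at_top.
       enn2ereal (delay M N W \<mu> (second_alarm N \<mu> h))
         \<le> ereal (4 / \<mu>\<^sup>2) *
             (ln_ext (ARL M N W \<mu> (second_alarm N \<mu> h))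
              + ereal (ln ((real N - 1) * \<mu>\<^sup>2 / 2) - 1 + ?\<epsilon> h))"
    using eventually_gt_at_top[of 0]
  proof eventually_elim
    case (elim h)
    let ?C = "(real N - 1) * \<mu>\<^sup>2 / 2" and ?R = "exp h - h - 1"
    have C: "0 < ?C" using assms by simp
    have "1 + h < exp h" using exp_minus_greater[of "- h"] elim by simp
    then have R: "0 < ?R" by simp
    have "?R = exp h * (1 - (h + 1) * exp (- h))"
      by (simp add: algebra_simps flip: exp_add)
    then have "ln ?R = h + ln (1 - (h + 1) * exp (- h))"
      using R by (auto simp: zero_less_mult_iff ln_mult)
    moreover have "ln (?R / ?C) = ln ?R - ln ?C" by (rule ln_divide_pos[OF R C])
    ultimately have ln: "ln (?R / ?C) + (ln ?C - 1 + ?\<epsilon> h) = h - 1 + exp (- h)" by linarith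
    have e: "2 / ((real N - 1) * \<mu>\<^sup>2) * ?R = ?R / ?C" by simp
    have "enn2ereal (delay M N W \<mu> (second_alarm N \<mu> h)) \<le> enn2ereal (ennreal (4 / \<mu>\<^sup>2 * (h - 1 + exp (- h))))"
      using delay_second_alarm_le[OF assms(2,1,3) elim] by (simp add: less_eq_ennreal.rep_eq)
    also have "\<dots> = ereal (4 / \<mu>\<^sup>2 * (h - 1 + exp (- h)))"
      using exp_ge_add_one_self[of "- h"]
      by (intro enn2ereal_ennreal mult_nonneg_nonneg) (simp, linarith)
    also have "\<dots> = ereal (4 / \<mu>\<^sup>2) * (ereal (ln (?R / ?C)) + ereal (ln ?C - 1 + ?\<epsilon> h))"
      unfolding plus_ereal.simps(1) times_ereal.simps(1) ln ..
    also have "\<dots> \<le> ereal (4 / \<mu>\<^sup>2) * (ln_ext (ARL M N W \<mu> (second_alarm N \<mu> h)) + ereal (ln ?C - 1 + ?\<epsilon> h))"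
    proof (intro ereal_mult_left_mono add_right_mono ln_le_ln_ext)
      show "0 < ?R / ?C" using R C by (rule divide_pos_pos)
      show "ennreal (?R / ?C) \<le> ARL M N W \<mu> (second_alarm N \<mu> h)"
        using ARL_second_alarm_ge[OF assms(2,1,3) elim] unfolding e .
    qed simp
    finally show ?case .
  qed
qed

end
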